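(* Let $N\colon M^n\to \mathbb{S}^n$ be a local diffeomorphism of a product manifold $M^n= M_0^{n-1}\times I$ such that the product net $\mathcal{E} = (E_0, E_1)$ of $M^n$ is orthogonal with respect to the metric $d\sigma^2$ induced by $N$ (equivalently, $N$ is a local diffeomorphism whose induced metric is $d\sigma^2=g_s+\rho^2ds^2$ for some $\rho\in C^{\infty}(M)$ and for some smooth family of metrics $g_s$ on $M_0^{n-1}$ indexed on $I$). If there exist a smooth curve $\gamma\colon I\to \mathbb{R}^{n+1}$ and $\alpha, \beta\in C^{\infty}(I)$ such that $$\langle\gamma', N\rangle+\alpha'=\beta\rho, \qquad (1)$$ then the map $f\colon M^n\to \mathbb{R}^{n+1}$ given by $$f=\gamma+\alpha N +\beta \rho^{-1}N_*\partial_s \qquad (2)$$ parametrizes a hypersurface of Enneper type with respect to $\mathcal{E}$ having $N$ as a Gauss map. Conversely, if $f\colon M^n= M_0^{n-1}\times I\to \mathbb{R}^{n+1}$ is a hypersurface of Enneper type with respect to the product net $\mathcal{E}= (E_0, E_1)$ of $M^n$ having a local diffeomorphism $N\colon M^n\to \mathbb{S}^n$ as a Gauss map, then there exist a smooth curve $\gamma\colon I\to \mathbb{R}^{n+1}$ and $\alpha, \beta\in C^{\infty}(I)$ satisfying (1) such that $f$ is given by (2), where $\rho$ is defined by writing the metric induced by $N$ as $g_s+\rho^2ds^2$.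
   Context: $I\subset\mathbb{R}$ is an open interval with standard coordinate $s$ and unit field $\partial_s$; prime denotes derivative with respect to $s$; $\rho>0$. The product net $(E_0,E_1)$ of $M_0\times I$ consists of the distributions formed by the tangent spaces to $M_0$ and to $I$; the leaves of $E_0$ are the sets $M_0\times\{s\}$. A hypersurface $f\colon M_0^{n-1}\times I\to\mathbb{R}^{n+1}$ is of Enneper type with respect to $\mathcal{E}$ if: (i) $\mathcal{E}$ is orthogonal with respect to the metric induced by $f$; (ii) the second fundamental form of $f$ is adapted to $\mathcal{E}$, i.e. $\alpha^f(X_0,X_1)=0$ for $X_0\in\Gamma(E_0)$, $X_1\in\Gamma(E_1)$; (iii') the image by $f$ of each leaf of $E_0$ is contained in a hypersphere of $\mathbb{R}^{n+1}$ (which does not necessarily intersect $f(M)$ orthogonally). Vectors tangent to $\mathbb{S}^n$ are regarded as vectors of $\mathbb{R}^{n+1}$.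
   Formalization: The converse assumes M_0 connected and a smooth choice of sphere centres near those s whose leaf lies in a hyperplane (without it the converse fails for smooth data); the direct part asserts the Enneper property and Gauss map only where f is an immersion. *)

theory Defs
  imports "HOL-Analysis.Analysis"
begin

fun C_k_on :: "nat \<Rightarrow> 'a::euclidean_space set \<Rightarrow> ('a \<Rightarrow> 'b::real_normed_vector) \<Rightarrow> bool" where
  "C_k_on 0 S f \<longleftrightarrow> continuous_on S f"
| "C_k_on (Suc k) S f \<longleftrightarrow> (\<forall>x\<in>S. f differentiable (at x)) \<and>
     (\<forall>v. C_k_on k S (\<lambda>x. frechet_derivative f (at x) v))"

text \<open>Derivatives are two-sided (\<open>at x\<close>, not \<open>at x within S\<close>), so \<open>S\<close> is meant to be open.\<close>

definition smooth_on :: "'a::euclidean_space set \<Rightarrow> ('a \<Rightarrow> 'b::real_normed_vector) \<Rightarrow> bool" where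
  "smooth_on S f \<longleftrightarrow> (\<forall>k. C_k_on k S f)"

text \<open>A chart is a pair \<open>(U, \<phi>)\<close>; the model space is a Euclidean space \<open>'e\<close>, so the
  manifold has dimension \<open>DIM('e)\<close>. A tangent vector at \<open>p\<close> is given by its coordinate
  vector \<open>u :: 'e\<close> in a chart around \<open>p\<close>.\<close>

type_synonym ('p, 'e) chart = "'p set \<times> ('p \<Rightarrow> 'e)"

definition chart_inv :: "('p, 'e) chart \<Rightarrow> 'e \<Rightarrow> 'p" where
  "chart_inv c = inv_into (fst c) (snd c)"

definition is_chart :: "('p::topological_space, 'e::euclidean_space) chart \<Rightarrow> bool" where
  "is_chart c \<longleftrightarrow> open (fst c) \<and> open (snd c ` fst c) \<and>
     homeomorphism (fst c) (snd c ` fst c) (snd c) (chart_inv c)"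

definition smooth_atlas ::
    "'p::topological_space set \<Rightarrow> ('p, 'e::euclidean_space) chart set \<Rightarrow> bool" where
  "smooth_atlas M A \<longleftrightarrow> (\<forall>c\<in>A. is_chart c) \<and> (\<Union>c\<in>A. fst c) = M \<and>
     (\<forall>c\<in>A. \<forall>d\<in>A. smooth_on (snd c ` (fst c \<inter> fst d)) (snd d \<circ> chart_inv c))"

definition smooth_map ::
    "('p, 'e::euclidean_space) chart set \<Rightarrow> 'p set \<Rightarrow> ('p \<Rightarrow> 'v::real_normed_vector) \<Rightarrow> bool" where
  "smooth_map A W f \<longleftrightarrow> (\<forall>c\<in>A. smooth_on (snd c ` (fst c \<inter> W)) (f \<circ> chart_inv c))"

text \<open>\<open>push c f p u\<close> is \<open>f\<^sub>* X\<close> for the tangent vector \<open>X\<close> at \<open>p\<close> with coordinates \<open>u\<close> in \<open>c\<close>.\<close>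

definition push ::
    "('p, 'e::euclidean_space) chart \<Rightarrow> ('p \<Rightarrow> 'v::real_normed_vector) \<Rightarrow> 'p \<Rightarrow> 'e \<Rightarrow> 'v" where
  "push c f p u = frechet_derivative (f \<circ> chart_inv c) (at (snd c p)) u"

definition induced_metric ::
    "('p, 'e::euclidean_space) chart \<Rightarrow> ('p \<Rightarrow> 'v::euclidean_space) \<Rightarrow> 'p \<Rightarrow> 'e \<Rightarrow> 'e \<Rightarrow> real" where
  "induced_metric c f p u v = push c f p u \<bullet> push c f p v"

definition immersion_at ::
    "('p, 'e::euclidean_space) chart set \<Rightarrow> ('p \<Rightarrow> 'v::euclidean_space) \<Rightarrow> 'p \<Rightarrow> bool" where
  "immersion_at A f p \<longleftrightarrow> (\<forall>c\<in>A. p \<in> fst c \<longrightarrow> inj (push c f p))"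

definition regular_points ::
    "('p, 'e::euclidean_space) chart set \<Rightarrow> ('p \<Rightarrow> 'v::euclidean_space) \<Rightarrow> 'p set" where
  "regular_points A f = {p \<in> (\<Union>c\<in>A. fst c). immersion_at A f p}"

text \<open>A local diffeomorphism onto open subsets of the unit sphere. The local inverse is
  \<open>\<phi>\<^sup>-\<^sup>1 \<circ> G\<close> on \<open>V \<inter> sphere 0 1\<close>: a map on an open subset of the embedded sphere is smooth
  iff it locally is the restriction of a smooth map \<open>G\<close> of the ambient space.\<close>

definition local_diffeo_to_sphere ::
    "('p::topological_space, 'e::euclidean_space) chart set \<Rightarrow> ('p \<Rightarrow> 'v::euclidean_space) \<Rightarrow> bool" where
  "local_diffeo_to_sphere A N \<longleftrightarrow>
     smooth_map A (\<Union>c\<in>A. fst c) N \<and> N ` (\<Union>c\<in>A. fst c) \<subseteq> sphere 0 1 \<and>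
     (\<forall>c\<in>A. \<forall>p\<in>fst c. \<exists>U V G. open U \<and> p \<in> U \<and> U \<subseteq> fst c \<and>
        open V \<and> N ` U = V \<inter> sphere 0 1 \<and>
        smooth_on V G \<and> (\<forall>q\<in>U. G (N q) = snd c q))"

text \<open>The codimension is one whenever \<open>DIM('v) = DIM('e) + 1\<close>.\<close>

definition hypersurface ::
    "('p, 'e::euclidean_space) chart set \<Rightarrow> 'p set \<Rightarrow> ('p \<Rightarrow> 'v::euclidean_space) \<Rightarrow> bool" where
  "hypersurface A W f \<longleftrightarrow> smooth_map A W f \<and> (\<forall>p\<in>W. immersion_at A f p)"

definition gauss_map ::
    "('p, 'e::euclidean_space) chart set \<Rightarrow> 'p set \<Rightarrow> ('p \<Rightarrow> 'v::euclidean_space) \<Rightarrow> ('p \<Rightarrow> 'v) \<Rightarrow> bool" where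
  "gauss_map A W f N \<longleftrightarrow> smooth_map A W N \<and>
     (\<forall>p\<in>W. norm (N p) = 1 \<and> (\<forall>c\<in>A. p \<in> fst c \<longrightarrow> (\<forall>u. N p \<bullet> push c f p u = 0)))"

definition normal_part :: "'v::euclidean_space set \<Rightarrow> 'v \<Rightarrow> 'v" where
  "normal_part T w = (THE \<nu>. \<nu> \<in> orthogonal_comp T \<and> w - \<nu> \<in> T)"

text \<open>The second fundamental form \<open>\<alpha>(X,Y) = (\<nabla>\<^sub>X f\<^sub>* Y)\<^sup>\<bottom>\<close>, where \<open>\<nabla>\<close> is the flat connection of the
  ambient space, i.e. the derivative of the vector-valued map \<open>q \<mapsto> f\<^sub>* Y(q)\<close>. The fields \<open>X\<close>, \<open>Y\<close>
  map a point of the chart domain to the coordinates of the vector in the chart.\<close>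

definition second_fundamental_form ::
    "('p, 'e::euclidean_space) chart \<Rightarrow> ('p \<Rightarrow> 'v::euclidean_space) \<Rightarrow>
     ('p \<Rightarrow> 'e) \<Rightarrow> ('p \<Rightarrow> 'e) \<Rightarrow> 'p \<Rightarrow> 'v" where
  "second_fundamental_form c f X Y p =
     normal_part (range (push c f p)) (push c (\<lambda>q. push c f q (Y q)) p (X p))"

definition prod_atlas ::
    "('m, 'e) chart set \<Rightarrow> real set \<Rightarrow> ('m \<times> real, 'e \<times> real) chart set" where
  "prod_atlas A I = {(U \<times> I, map_prod \<phi> id) | U \<phi>. (U, \<phi>) \<in> A}"

text \<open>In the coordinates of every chart of \<open>prod_atlas A I\<close> the two distributions of the
  product net are the constant subspaces tangent to the two factors.\<close>

definition E0 :: "('e::euclidean_space \<times> real) set" where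
  "E0 = UNIV \<times> {0}"

definition E1 :: "('e::euclidean_space \<times> real) set" where
  "E1 = {0} \<times> UNIV"

definition orthogonal_net ::
    "('p, 'e::euclidean_space \<times> real) chart set \<Rightarrow> 'p set \<Rightarrow> ('p \<Rightarrow> 'v::euclidean_space) \<Rightarrow> bool" where
  "orthogonal_net A W f \<longleftrightarrow>
     (\<forall>c\<in>A. \<forall>p\<in>fst c \<inter> W. \<forall>u\<in>E0. \<forall>v\<in>E1. induced_metric c f p u v = 0)"

definition adapted_sff ::
    "('p, 'e::euclidean_space \<times> real) chart set \<Rightarrow> 'p set \<Rightarrow> ('p \<Rightarrow> 'v::euclidean_space) \<Rightarrow> bool" where
  "adapted_sff A W f \<longleftrightarrow>
     (\<forall>c\<in>A. \<forall>X Y. smooth_map {c} (fst c) X \<and> X ` fst c \<subseteq> E0 \<and>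
                  smooth_map {c} (fst c) Y \<and> Y ` fst c \<subseteq> E1 \<longrightarrow>
        (\<forall>p\<in>fst c \<inter> W. second_fundamental_form c f X Y p = 0))"

text \<open>The restriction of \<open>f\<close> to an open subset \<open>W\<close> of \<open>M0 \<times> I\<close> is a hypersurface of Enneper type
  with respect to the product net. Leaves of \<open>E0\<close> are the slices \<open>M0 \<times> {s}\<close>; the spheres are not required to
  vary continuously with \<open>s\<close>.\<close>

definition enneper_type ::
    "('m, 'e::euclidean_space) chart set \<Rightarrow> 'm set \<Rightarrow> real set \<Rightarrow> ('m \<times> real) set \<Rightarrow>
     ('m \<times> real \<Rightarrow> 'v::euclidean_space) \<Rightarrow> bool" where
  "enneper_type A M0 I W f \<longleftrightarrow>
     hypersurface (prod_atlas A I) W f \<and>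
     orthogonal_net (prod_atlas A I) W f \<and>
     adapted_sff (prod_atlas A I) W f \<and>
     (\<forall>s\<in>I. \<exists>c r. 0 < r \<and> f ` (W \<inter> (M0 \<times> {s})) \<subseteq> sphere c r)"

text \<open>A smooth family of Riemannian metrics \<open>g\<^sub>s\<close> on the manifold with atlas \<open>A\<close>: \<open>g s c p\<close> is the
  coordinate expression in the chart \<open>c\<close> of the inner product on the tangent space at \<open>p\<close>. The
  last condition is the transformation rule, \<open>push c (snd d) p\<close> being the coordinate change.\<close>

definition smooth_metric_family ::
    "('m, 'e::euclidean_space) chart set \<Rightarrow> real set \<Rightarrow>
     (real \<Rightarrow> ('m, 'e) chart \<Rightarrow> 'm \<Rightarrow> 'e \<Rightarrow> 'e \<Rightarrow> real) \<Rightarrow> bool" where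
  "smooth_metric_family A I g \<longleftrightarrow>
     (\<forall>c\<in>A.
        (\<forall>u v. smooth_on ((snd c ` fst c) \<times> I) (\<lambda>(x, s). g s c (chart_inv c x) u v)) \<and>
        (\<forall>p\<in>fst c. \<forall>s\<in>I.
           bilinear (g s c p) \<and>
           (\<forall>u v. g s c p u v = g s c p v u) \<and>
           (\<forall>u. u \<noteq> 0 \<longrightarrow> 0 < g s c p u u)) \<and>
        (\<forall>d\<in>A. \<forall>p\<in>fst c \<inter> fst d. \<forall>s\<in>I. \<forall>u v.
           g s d p (push c (snd d) p u) (push c (snd d) p v) = g s c p u v))"

definition induced_metric_splits ::
    "('m, 'e::euclidean_space) chart set \<Rightarrow> 'm set \<Rightarrow> real set \<Rightarrow> ('m \<times> real \<Rightarrow> 'v::euclidean_space) \<Rightarrow>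
     (real \<Rightarrow> ('m, 'e) chart \<Rightarrow> 'm \<Rightarrow> 'e \<Rightarrow> 'e \<Rightarrow> real) \<Rightarrow> ('m \<times> real \<Rightarrow> real) \<Rightarrow> bool" where
  "induced_metric_splits A M0 I N g \<rho> \<longleftrightarrow>
     smooth_metric_family A I g \<and>
     smooth_map (prod_atlas A I) (M0 \<times> I) \<rho> \<and> (\<forall>p\<in>M0. \<forall>s\<in>I. 0 < \<rho> (p, s)) \<and>
     (\<forall>(U, \<phi>)\<in>A. \<forall>p\<in>U. \<forall>s\<in>I. \<forall>u v a b.
        induced_metric (U \<times> I, map_prod \<phi> id) N (p, s) (u, a) (v, b) =
          g s (U, \<phi>) p u v + (\<rho> (p, s))\<^sup>2 * (a * b))"

definition push_ds :: "('m \<times> real \<Rightarrow> 'v::real_normed_vector) \<Rightarrow> 'm \<Rightarrow> real \<Rightarrow> 'v" where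
  "push_ds N p s = vector_derivative (\<lambda>t. N (p, t)) (at s)"

definition compatibility_eq ::
    "'m set \<Rightarrow> real set \<Rightarrow> ('m \<times> real \<Rightarrow> 'v::euclidean_space) \<Rightarrow> ('m \<times> real \<Rightarrow> real) \<Rightarrow>
     (real \<Rightarrow> 'v) \<Rightarrow> (real \<Rightarrow> real) \<Rightarrow> (real \<Rightarrow> real) \<Rightarrow> bool" where
  "compatibility_eq M0 I N \<rho> \<gamma> \<alpha> \<beta> \<longleftrightarrow> (\<forall>p\<in>M0. \<forall>s\<in>I.
     vector_derivative \<gamma> (at s) \<bullet> N (p, s) + deriv \<alpha> s = \<beta> s * \<rho> (p, s))"

definition enneper_param ::
    "'m set \<Rightarrow> real set \<Rightarrow> ('m \<times> real \<Rightarrow> 'v::euclidean_space) \<Rightarrow> ('m \<times> real \<Rightarrow> real) \<Rightarrow>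
     (real \<Rightarrow> 'v) \<Rightarrow> (real \<Rightarrow> real) \<Rightarrow> (real \<Rightarrow> real) \<Rightarrow> ('m \<times> real \<Rightarrow> 'v) \<Rightarrow> bool" where
  "enneper_param M0 I N \<rho> \<gamma> \<alpha> \<beta> f \<longleftrightarrow> (\<forall>p\<in>M0. \<forall>s\<in>I.
     f (p, s) = \<gamma> s + \<alpha> s *\<^sub>R N (p, s) + (\<beta> s * inverse (\<rho> (p, s))) *\<^sub>R push_ds N p s)"

text \<open>The centre of a hypersphere containing \<open>f (M0 \<times> {s})\<close> is unique, and hence depends smoothly
  on \<open>s\<close>, as long as \<open>f (M0 \<times> {s})\<close> is not contained in a hyperplane. Near parameters
  where it is, the centres need not admit a smooth choice even if \<open>f\<close> is smooth and every
  \<open>f (M0 \<times> {s})\<close> is contained in a hypersphere; the following condition excludes this, and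
  holds trivially (\<open>J = {}\<close>) if there are no such parameters.\<close>

definition planar_parameters ::
    "'m set \<Rightarrow> real set \<Rightarrow> ('m \<times> real \<Rightarrow> 'v::euclidean_space) \<Rightarrow> real set" where
  "planar_parameters M0 I f = {s\<in>I. \<exists>a b. a \<noteq> 0 \<and> f ` (M0 \<times> {s}) \<subseteq> {x. a \<bullet> x = b}}"

definition smooth_centres_near_planar_leaves ::
    "'m set \<Rightarrow> real set \<Rightarrow> ('m \<times> real \<Rightarrow> 'v::euclidean_space) \<Rightarrow> bool" where
  "smooth_centres_near_planar_leaves M0 I f \<longleftrightarrow>
     (\<exists>J z. open J \<and> planar_parameters M0 I f \<subseteq> J \<and> J \<subseteq> I \<and> smooth_on J z \<and>
        (\<forall>s\<in>J. \<exists>r>0. f ` (M0 \<times> {s}) \<subseteq> sphere (z s) r))"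

end

theory Submission
  imports Defs
begin

text \<open>Put \<open>e = \<rho>\<^sup>-\<^sup>1 N\<^sub>* \<partial>\<^sub>s\<close>. As \<open>N\<^sub>* E\<^sub>0\<close> is the orthogonal complement of \<open>N\<close> and \<open>e\<close>, everything reduces to
  inner products. For \<open>f = \<gamma> + \<alpha> N + \<beta> e\<close>, equation (1) says \<open>\<langle>f\<^sub>* \<partial>\<^sub>s, N\<rangle> = 0\<close>, and its derivative along \<open>E\<^sub>0\<close>
  says that \<open>f\<^sub>* \<partial>\<^sub>s\<close> is orthogonal to \<open>N\<^sub>* E\<^sub>0\<close>, so that \<open>f\<^sub>* \<partial>\<^sub>s\<close> is a multiple of \<open>e\<close>; the leaves are spherical
  since \<open>|f - \<gamma>|\<^sup>2 = \<alpha>\<^sup>2 + \<beta>\<^sup>2\<close>.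

  Conversely, adaptedness gives \<open>f\<^sub>* E\<^sub>0 = N\<^sub>* E\<^sub>0\<close>. For every centre \<open>c\<close> of a sphere containing a leaf, \<open>f - c\<close> is
  orthogonal to \<open>f\<^sub>* E\<^sub>0\<close>, hence a combination of \<open>N\<close> and \<open>e\<close>, whose coefficients have vanishing derivative along
  the leaf. So any choice of centres \<open>\<gamma>\<close> yields (2), and (1) follows from \<open>\<langle>f\<^sub>* \<partial>\<^sub>s, N\<rangle> = 0\<close>. Away from planar
  leaves the choice is automatically smooth, because \<open>\<gamma>(s)\<close> solves the linear system
  \<open>2 \<langle>\<gamma>, f(p, s) - f(p\<^sub>0, s)\<rangle> = |f(p, s)|\<^sup>2 - |f(p\<^sub>0, s)|\<^sup>2\<close>, which has full rank.\<close>

section \<open>Smooth functions on open sets\<close>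

abbreviation D :: "('a::real_normed_vector \<Rightarrow> 'b::real_normed_vector) \<Rightarrow> 'a \<Rightarrow> 'a \<Rightarrow> 'b" where
  "D f x \<equiv> frechet_derivative f (at x)"

lemma D_eqI: "(f has_derivative f') (at x) \<Longrightarrow> D f x v = f' v"
  using frechet_derivative_at[of f f' x] by simp

lemma D_works: "f differentiable (at x) \<Longrightarrow> (f has_derivative D f x) (at x)"
  using frechet_derivative_works by blast

lemma differentiable_at_cong:
  assumes "open S" "x \<in> S" "\<And>y. y \<in> S \<Longrightarrow> f y = g y" "f differentiable (at x)"
  shows "g differentiable (at x)"
  using assms by (meson differentiable_def has_derivative_transform_within_open)

lemma D_cong:
  assumes "open S" "x \<in> S" "\<And>y. y \<in> S \<Longrightarrow> f y = g y" "f differentiable (at x)"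
  shows "D f x v = D g x v"
  using frechet_derivative_transform_within_open[OF assms(4,1,2), of g] assms(3) by simp

lemma D_locally_const:
  assumes "open S" "x \<in> S" "\<And>y. y \<in> S \<Longrightarrow> f y = c"
  shows "D f x v = 0"
  using D_cong[OF assms(1,2), of "\<lambda>_. c" f v] assms(3) by simp

lemma D_add: "f differentiable (at x) \<Longrightarrow> g differentiable (at x) \<Longrightarrow>
    D (\<lambda>x. f x + g x) x v = D f x v + D g x v"
  by (rule D_eqI) (auto intro!: derivative_eq_intros D_works)

lemma D_bilinear:
  assumes "bounded_bilinear h" "f differentiable (at x)" "g differentiable (at x)"
  shows "D (\<lambda>x. h (f x) (g x)) x v = h (f x) (D g x v) + h (D f x v) (g x)"
  by (rule D_eqI) (rule bounded_bilinear.FDERIV[OF assms(1)]; intro D_works assms)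

lemma differentiable_bilinear:
  assumes "bounded_bilinear h" "f differentiable (at x)" "g differentiable (at x)"
  shows "(\<lambda>x. h (f x) (g x)) differentiable (at x)"
  using bounded_bilinear.FDERIV[OF assms(1)] assms(2,3) unfolding differentiable_def by blast

lemma D_bounded_linear:
  assumes "bounded_linear h" "f differentiable (at x)"
  shows "D (\<lambda>x. h (f x)) x v = h (D f x v)"
  by (rule D_eqI) (rule bounded_linear.has_derivative[OF assms(1)]; intro D_works assms)

lemma D_linear: "f differentiable (at x) \<Longrightarrow> linear (D f x)"
  by (rule linear_frechet_derivative)

lemma D_compose:
  assumes "g differentiable (at x)" "f differentiable (at (g x))"
  shows "D (\<lambda>x. f (g x)) x v = D f (g x) (D g x v)"
  using frechet_derivative_compose[OF assms] by (simp add: o_def fun_eq_iff)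

text \<open>\<open>C_k_on\<close> speaks only of derivatives in a fixed direction. This expansion
  turns a derivative in a direction that varies with the point into a finite combination of such
  derivatives.\<close>

lemma D_sum_Basis:
  fixes f :: "'a::euclidean_space \<Rightarrow> 'b::real_normed_vector"
  assumes "f differentiable (at x)"
  shows "D f x v = (\<Sum>b\<in>Basis. (v \<bullet> b) *\<^sub>R D f x b)"
proof -
  interpret linear "D f x" by (rule D_linear[OF assms])
  have "D f x v = D f x (\<Sum>b\<in>Basis. (v \<bullet> b) *\<^sub>R b)" by (simp add: euclidean_representation)
  then show ?thesis by (simp add: sum scale)
qed

section \<open>Closure properties of the classes \<open>C_k_on k\<close>\<close>

lemma C_k_on_subset: "C_k_on k S f \<Longrightarrow> T \<subseteq> S \<Longrightarrow> C_k_on k T f"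
  by (induction k arbitrary: f) (auto intro: continuous_on_subset)

lemma C_k_on_cong:
  assumes "open S"
  shows "(\<And>x. x \<in> S \<Longrightarrow> f x = g x) \<Longrightarrow> C_k_on k S f \<Longrightarrow> C_k_on k S g"
proof (induction k arbitrary: f g)
  case 0 then show ?case using continuous_on_cong[OF refl, of S f g] by simp
next
  case (Suc k)
  have "g differentiable (at x)" if "x \<in> S" for x
    using differentiable_at_cong[OF assms that Suc.prems(1)] Suc.prems(2) that by simp
  moreover have "C_k_on k S (\<lambda>x. D g x v)" for v
    by (rule Suc.IH[of "\<lambda>x. D f x v"]) (use Suc.prems D_cong[OF assms, of _ f g] in auto)
  ultimately show ?case by simp
qed

lemma C_k_on_local:
  "(\<And>x. x \<in> S \<Longrightarrow> \<exists>U. open U \<and> x \<in> U \<and> C_k_on k U f) \<Longrightarrow> C_k_on k S f"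
proof (induction k arbitrary: f)
  case 0
  have "isCont f x" if "x \<in> S" for x
    using 0[OF that] continuous_on_eq_continuous_at by auto
  then show ?case by (simp add: continuous_at_imp_continuous_on)
next
  case (Suc k)
  have "C_k_on k S (\<lambda>x. D f x v)" for v
    by (rule Suc.IH) (use Suc.prems in force)
  then show ?case using Suc.prems by fastforce
qed

lemma C_k_on_lower: "C_k_on (Suc k) S f \<Longrightarrow> C_k_on k S f"
proof (induction k arbitrary: f)
  case 0
  then show ?case
    by (auto intro!: continuous_at_imp_continuous_on differentiable_imp_continuous_within)
next
  case (Suc k)
  show ?case using Suc.IH Suc.prems by simp
qed

lemma C_k_on_const: "C_k_on k S (\<lambda>x. c)"
  by (induction k arbitrary: c) simp_all

lemma C_k_on_add:
  "open S \<Longrightarrow> C_k_on k S f \<Longrightarrow> C_k_on k S g \<Longrightarrow> C_k_on k S (\<lambda>x. f x + g x)"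
proof (induction k arbitrary: f g)
  case 0 then show ?case by (simp add: continuous_on_add)
next
  case (Suc k)
  have "C_k_on k S (\<lambda>x. D (\<lambda>x. f x + g x) x v)" for v
    by (rule C_k_on_cong[of _ "\<lambda>x. D f x v + D g x v"]) (use Suc in \<open>auto simp: D_add\<close>)
  then show ?case using Suc.prems by simp
qed

text \<open>By the product rule the derivative is a sum of two terms of the same shape in which one
  factor stays underived; \<open>C_k_on_lower\<close> supplies that factor at order
  \<open>k\<close>. One proof covers scalar multiples, products and inner products.\<close>

lemma C_k_on_bilinear:
  assumes "bounded_bilinear h" "open S"
  shows "C_k_on k S f \<Longrightarrow> C_k_on k S g \<Longrightarrow> C_k_on k S (\<lambda>x. h (f x) (g x))"
proof (induction k arbitrary: f g)
  case 0 then show ?case using bounded_bilinear.continuous_on[OF assms(1)] by simp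
next
  case (Suc k)
  have fg: "C_k_on k S f" "C_k_on k S g" using Suc.prems C_k_on_lower by blast+
  have "C_k_on k S (\<lambda>x. D (\<lambda>x. h (f x) (g x)) x v)" for v
    by (rule C_k_on_cong[of _ "\<lambda>x. h (f x) (D g x v) + h (D f x v) (g x)"])
      (use Suc fg assms in \<open>auto simp: D_bilinear[OF assms(1)] intro!: C_k_on_add\<close>)
  then show ?case using Suc.prems by (simp add: differentiable_bilinear[OF assms(1)])
qed

lemma C_k_on_linear:
  assumes "bounded_linear h" "open S"
  shows "C_k_on k S f \<Longrightarrow> C_k_on k S (\<lambda>x. h (f x))"
proof (induction k arbitrary: f)
  case 0 then show ?case using bounded_linear.continuous_on[OF assms(1)] by simp
next
  case (Suc k)
  have "C_k_on k S (\<lambda>x. D (\<lambda>x. h (f x)) x v)" for v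
    by (rule C_k_on_cong[of _ "\<lambda>x. h (D f x v)"])
      (use Suc assms in \<open>auto simp: D_bounded_linear[OF assms(1)]\<close>)
  moreover have "(\<lambda>x. h (f x)) differentiable (at x)" if "x \<in> S" for x
    using bounded_linear.has_derivative[OF assms(1) D_works, of f x] Suc.prems that
    by (auto simp: differentiable_def)
  ultimately show ?case by simp
qed

lemma C_k_on_sum:
  "open S \<Longrightarrow> (\<And>i. i \<in> J \<Longrightarrow> C_k_on k S (f i)) \<Longrightarrow> C_k_on k S (\<lambda>x. \<Sum>i\<in>J. f i x)"
  by (induction J rule: infinite_finite_induct) (auto intro: C_k_on_const C_k_on_add)

text \<open>Induction with \<open>g\<close> fixed and \<open>f\<close> arbitrary: the chain rule
  expresses the derivative through the components of \<open>D g x v\<close> and the partial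
  derivatives of \<open>f\<close> composed with \<open>g\<close>, to which the induction hypothesis
  applies.\<close>

lemma C_k_on_compose:
  fixes f :: "'b::euclidean_space \<Rightarrow> 'c::real_normed_vector"
    and g :: "'a::euclidean_space \<Rightarrow> 'b"
  assumes "open S" "g ` S \<subseteq> T"
  shows "C_k_on k T f \<Longrightarrow> C_k_on k S g \<Longrightarrow> C_k_on k S (\<lambda>x. f (g x))"
proof (induction k arbitrary: f)
  case 0 then show ?case using assms by (auto intro: continuous_on_compose2)
next
  case (Suc k)
  have g: "C_k_on k S g" using Suc.prems C_k_on_lower by blast
  have df: "f differentiable (at (g x))" if "x \<in> S" for x
    using Suc.prems assms that by auto
  have dg: "g differentiable (at x)" if "x \<in> S" for x
    using Suc.prems assms that by auto
  have "C_k_on k S (\<lambda>x. D (\<lambda>x. f (g x)) x v)" for v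
  proof (rule C_k_on_cong[of _ "\<lambda>x. \<Sum>b\<in>Basis. (D g x v \<bullet> b) *\<^sub>R D f (g x) b"])
    show "(\<Sum>b\<in>Basis. (D g x v \<bullet> b) *\<^sub>R D f (g x) b) = D (\<lambda>x. f (g x)) x v"
      if "x \<in> S" for x
      using D_compose[OF dg[OF that] df[OF that]] D_sum_Basis[OF df[OF that]] by metis
    show "C_k_on k S (\<lambda>x. \<Sum>b\<in>Basis. (D g x v \<bullet> b) *\<^sub>R D f (g x) b)"
      by (intro C_k_on_sum C_k_on_bilinear[OF bounded_bilinear_scaleR]
          C_k_on_linear[OF bounded_linear_inner_left] Suc.IH assms g)
        (use Suc.prems in auto)
  qed (rule assms)
  moreover have "(\<lambda>x. f (g x)) differentiable (at x)" if "x \<in> S" for x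
    using differentiable_chain_at[OF dg[OF that] df[OF that]] by (simp add: o_def)
  ultimately show ?case by simp
qed

section \<open>Smoothness, inherited from all finite orders\<close>

lemma smooth_on_C_k: "smooth_on S f \<Longrightarrow> C_k_on k S f"
  by (simp add: smooth_on_def)

lemma smooth_on_differentiable: "smooth_on S f \<Longrightarrow> x \<in> S \<Longrightarrow> f differentiable (at x)"
  using smooth_on_C_k[of S f "Suc 0"] by simp

lemma smooth_on_D: "smooth_on S f \<Longrightarrow> smooth_on S (\<lambda>x. D f x v)"
  unfolding smooth_on_def by (metis C_k_on.simps(2))

lemma smooth_on_continuous: "smooth_on S f \<Longrightarrow> continuous_on S f"
  using smooth_on_C_k[of S f 0] by simp

lemma smooth_on_subset: "smooth_on S f \<Longrightarrow> T \<subseteq> S \<Longrightarrow> smooth_on T f"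
  unfolding smooth_on_def using C_k_on_subset by blast

lemma smooth_on_cong:
  "open S \<Longrightarrow> (\<And>x. x \<in> S \<Longrightarrow> f x = g x) \<Longrightarrow> smooth_on S f \<Longrightarrow> smooth_on S g"
  unfolding smooth_on_def using C_k_on_cong by blast

text \<open>Lets the smoothness of the curve of centres be checked near one parameter at a time, by
  different arguments at planar and at other leaves.\<close>

lemma smooth_on_local:
  "(\<And>x. x \<in> S \<Longrightarrow> \<exists>U. open U \<and> x \<in> U \<and> smooth_on U f) \<Longrightarrow> smooth_on S f"
  unfolding smooth_on_def by (metis C_k_on_local)

lemma smooth_on_const: "smooth_on S (\<lambda>x. c)"
  by (simp add: smooth_on_def C_k_on_const)

lemma smooth_on_add:
  "open S \<Longrightarrow> smooth_on S f \<Longrightarrow> smooth_on S g \<Longrightarrow> smooth_on S (\<lambda>x. f x + g x)"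
  by (simp add: smooth_on_def C_k_on_add)

lemma smooth_on_linear:
  "bounded_linear h \<Longrightarrow> open S \<Longrightarrow> smooth_on S f \<Longrightarrow> smooth_on S (\<lambda>x. h (f x))"
  by (simp add: smooth_on_def C_k_on_linear)

lemma smooth_on_minus: "open S \<Longrightarrow> smooth_on S f \<Longrightarrow> smooth_on S (\<lambda>x. - f x)"
  by (rule smooth_on_linear[OF bounded_linear_minus[OF bounded_linear_ident]])

lemma smooth_on_diff:
  "open S \<Longrightarrow> smooth_on S f \<Longrightarrow> smooth_on S g \<Longrightarrow> smooth_on S (\<lambda>x. f x - g x)"
  using smooth_on_add[of S f "\<lambda>x. - g x"] smooth_on_minus[of S g] by simp

lemma smooth_on_scaleR:
  "open S \<Longrightarrow> smooth_on S f \<Longrightarrow> smooth_on S g \<Longrightarrow> smooth_on S (\<lambda>x. f x *\<^sub>R g x)"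
  by (simp add: smooth_on_def C_k_on_bilinear[OF bounded_bilinear_scaleR])

lemma smooth_on_mult:
  fixes f g :: "'a::euclidean_space \<Rightarrow> real"
  shows "open S \<Longrightarrow> smooth_on S f \<Longrightarrow> smooth_on S g \<Longrightarrow> smooth_on S (\<lambda>x. f x * g x)"
  by (simp add: smooth_on_def C_k_on_bilinear[OF bounded_bilinear_mult])

lemma smooth_on_inner:
  "open S \<Longrightarrow> smooth_on S f \<Longrightarrow> smooth_on S g \<Longrightarrow> smooth_on S (\<lambda>x. f x \<bullet> g x)"
  by (simp add: smooth_on_def C_k_on_bilinear[OF bounded_bilinear_inner])

lemma smooth_on_sum:
  "open S \<Longrightarrow> (\<And>i. i \<in> J \<Longrightarrow> smooth_on S (f i)) \<Longrightarrow> smooth_on S (\<lambda>x. \<Sum>i\<in>J. f i x)"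
  by (simp add: smooth_on_def C_k_on_sum)

lemma smooth_on_compose:
  fixes f :: "'b::euclidean_space \<Rightarrow> 'c::real_normed_vector"
    and g :: "'a::euclidean_space \<Rightarrow> 'b"
  shows "open S \<Longrightarrow> g ` S \<subseteq> T \<Longrightarrow> smooth_on T f \<Longrightarrow> smooth_on S g \<Longrightarrow>
    smooth_on S (\<lambda>x. f (g x))"
  unfolding smooth_on_def using C_k_on_compose by metis

lemma smooth_on_id: "smooth_on S (\<lambda>x. x)"
proof -
  have "C_k_on k S (\<lambda>x. x)" for k
    by (cases k) (simp_all add: C_k_on_const continuous_on_id)
  then show ?thesis by (simp add: smooth_on_def)
qed

lemma smooth_on_bounded_linear: "bounded_linear h \<Longrightarrow> open S \<Longrightarrow> smooth_on S h"
  using smooth_on_linear[OF _ _ smooth_on_id] .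

lemma smooth_on_Pair:
  assumes "open S" "smooth_on S f" "smooth_on S g"
  shows "smooth_on S (\<lambda>x. (f x, g x))"
proof -
  have "smooth_on S (\<lambda>x. (f x, 0) + (0, g x))"
    using assms by (intro smooth_on_add
      smooth_on_linear[OF bounded_linear_Pair[OF bounded_linear_ident bounded_linear_zero]]
      smooth_on_linear[OF bounded_linear_Pair[OF bounded_linear_zero bounded_linear_ident]])
  then show ?thesis by simp
qed

text \<open>The derivative of \<open>inverse\<close> is a multiple of
  \<open>inverse x * inverse x\<close>, so the product rule alone carries the induction.\<close>

lemma smooth_on_inverse_real: "smooth_on (-{0::real}) inverse"
proof -
  have op: "open (-{0::real})" by auto
  have "C_k_on k (-{0::real}) inverse" for k
  proof (induction k)
    case 0 then show ?case by (auto intro!: continuous_intros)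
  next
    case (Suc k)
    have d: "D inverse x v = - (inverse x * v * inverse x)" if "x \<in> -{0::real}" for x v :: real
      by (rule D_eqI) (use that in \<open>auto intro!: derivative_eq_intros\<close>)
    have "C_k_on k (-{0::real}) (\<lambda>x. D inverse x v)" for v
    proof (rule C_k_on_cong[OF op])
      show "(- v) * (inverse x * inverse x) = D inverse x v" if "x \<in> -{0}" for x
        using d[OF that] by simp
      show "C_k_on k (-{0::real}) (\<lambda>x. (- v) * (inverse x * inverse x))"
        by (intro C_k_on_const C_k_on_bilinear[OF bounded_bilinear_mult op] Suc)
    qed
    moreover have "inverse differentiable (at x)" if "x \<in> -{0::real}" for x
      using that by (auto intro!: derivative_intros)
    ultimately show ?case by simp
  qed
  then show ?thesis by (simp add: smooth_on_def)
qed

lemma smooth_on_sqrt: "smooth_on {0<..} sqrt"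
proof -
  have op: "open {0::real<..}" by auto
  have i: "C_k_on k {0::real<..} inverse" for k
    by (rule C_k_on_subset[OF smooth_on_C_k[OF smooth_on_inverse_real]]) auto
  have "C_k_on k {0<..} sqrt" for k
  proof (induction k)
    case 0 then show ?case by (auto intro!: continuous_intros)
  next
    case (Suc k)
    have der: "(sqrt has_derivative (*) (inverse (sqrt x) / 2)) (at x)" if "0 < x" for x
      using DERIV_real_sqrt[OF that] by (simp add: has_field_derivative_def)
    \<comment> \<open>The factor \<open>1 / sqrt x\<close> is written as
      \<open>sqrt x * inverse x\<close>: then only \<open>sqrt\<close> and the smooth function
      \<open>inverse\<close> occur, and the induction closes.\<close>
    have d: "D sqrt x v = (v / 2) * (sqrt x * inverse x)" if "x \<in> {0<..}" for x v :: real
    proof -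
      have "inverse x = inverse (sqrt x) * inverse (sqrt x)"
        using that by (simp flip: inverse_mult_distrib)
      then show ?thesis using D_eqI[OF der, of x v] that by simp
    qed
    have "C_k_on k {0<..} (\<lambda>x. D sqrt x v)" for v
    proof (rule C_k_on_cong[OF op])
      show "(v / 2) * (sqrt x * inverse x) = D sqrt x v" if "x \<in> {0<..}" for x
        using d[OF that] by simp
      show "C_k_on k {0<..} (\<lambda>x. (v / 2) * (sqrt x * inverse x))"
        by (intro C_k_on_const C_k_on_bilinear[OF bounded_bilinear_mult op] Suc i)
    qed
    moreover have "sqrt differentiable (at x)" if "0 < x" for x
      using der[OF that] differentiable_def by blast
    ultimately show ?case by simp
  qed
  then show ?thesis by (simp add: smooth_on_def)
qed

lemma smooth_on_inverse:
  fixes f :: "'a::euclidean_space \<Rightarrow> real"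
  shows "open S \<Longrightarrow> smooth_on S f \<Longrightarrow> (\<And>x. x \<in> S \<Longrightarrow> f x \<noteq> 0) \<Longrightarrow>
    smooth_on S (\<lambda>x. inverse (f x))"
  by (rule smooth_on_compose[OF _ _ smooth_on_inverse_real]) auto

lemma smooth_on_norm:
  fixes f :: "'a::euclidean_space \<Rightarrow> 'b::real_inner"
  assumes "open S" "smooth_on S f" "\<And>x. x \<in> S \<Longrightarrow> f x \<noteq> 0"
  shows "smooth_on S (\<lambda>x. norm (f x))"
  unfolding norm_eq_sqrt_inner
  by (rule smooth_on_compose[OF _ _ smooth_on_sqrt smooth_on_inner]) (use assms in auto)

text \<open>Needed for the fields \<open>f\<^sub>* Y\<close> with \<open>Y\<close> varying; the sum
  over the basis separates \<open>Y\<close> from the derivatives of \<open>f\<close>.\<close>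

lemma smooth_on_D_field:
  assumes "open S" "smooth_on S f" "smooth_on S Y"
  shows "smooth_on S (\<lambda>x. D f x (Y x))"
proof (rule smooth_on_cong[OF assms(1)])
  show "(\<Sum>b\<in>Basis. (Y x \<bullet> b) *\<^sub>R D f x b) = D f x (Y x)" if "x \<in> S" for x
    using D_sum_Basis[OF smooth_on_differentiable[OF assms(2) that]] by metis
  show "smooth_on S (\<lambda>x. \<Sum>b\<in>Basis. (Y x \<bullet> b) *\<^sub>R D f x b)"
    by (intro smooth_on_sum smooth_on_scaleR smooth_on_inner smooth_on_const smooth_on_D assms)
qed

lemma D_inner:
  "f differentiable (at x) \<Longrightarrow> g differentiable (at x) \<Longrightarrow>
    D (\<lambda>x. f x \<bullet> g x) x v = f x \<bullet> D g x v + D f x v \<bullet> g x"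
  by (rule D_bilinear[OF bounded_bilinear_inner])

lemma D_scaleR:
  "f differentiable (at x) \<Longrightarrow> g differentiable (at x) \<Longrightarrow>
    D (\<lambda>x. f x *\<^sub>R g x) x v = f x *\<^sub>R D g x v + D f x v *\<^sub>R g x"
  by (rule D_bilinear[OF bounded_bilinear_scaleR])

text \<open>Differentiating a constant inner product moves the derivative from one factor to the
  other. All relations between the derivatives of the Gauss map, of the unit field \<open>e\<close>
  and of the hypersurface are obtained in this way.\<close>

lemma D_inner_const:
  assumes "open S" "x \<in> S" "smooth_on S f" "smooth_on S g" "\<And>y. y \<in> S \<Longrightarrow> f y \<bullet> g y = c"
  shows "f x \<bullet> D g x v = - (D f x v \<bullet> g x)"
  using D_locally_const[OF assms(1,2), of "\<lambda>x. f x \<bullet> g x" c v]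
    D_inner[OF smooth_on_differentiable[OF assms(3,2)] smooth_on_differentiable[OF assms(4,2)], of v]
    assms(5) by simp

section \<open>Symmetry of the second derivative\<close>

lemma D_along_line:
  fixes f :: "'a::euclidean_space \<Rightarrow> real"
  assumes "f differentiable (at (x + t *\<^sub>R u))"
  shows "((\<lambda>t. f (x + t *\<^sub>R u)) has_real_derivative D f (x + t *\<^sub>R u) u) (at t)"
proof -
  interpret linear "D f (x + t *\<^sub>R u)" by (rule D_linear[OF assms])
  have "((\<lambda>t. f (x + t *\<^sub>R u)) has_derivative (\<lambda>h. D f (x + t *\<^sub>R u) (h *\<^sub>R u))) (at t)"
    by (rule has_derivative_compose[where f = "\<lambda>t. x + t *\<^sub>R u", OF _ D_works[OF assms]])
      (auto intro!: derivative_eq_intros)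
  then show ?thesis by (simp add: has_field_derivative_def scale mult_commute_abs)
qed

lemma mvt_along_line:
  fixes f :: "'a::euclidean_space \<Rightarrow> real"
  assumes "t > 0" "\<And>z. 0 \<le> z \<Longrightarrow> z \<le> t \<Longrightarrow> f differentiable (at (x + z *\<^sub>R u))"
  shows "\<exists>z>0. z < t \<and> f (x + t *\<^sub>R u) - f x = t * D f (x + z *\<^sub>R u) u"
proof -
  have "\<exists>z. 0 < z \<and> z < t \<and> f (x + t *\<^sub>R u) - f (x + 0 *\<^sub>R u) = (t - 0) * D f (x + z *\<^sub>R u) u"
    by (rule MVT2[OF assms(1)]) (rule D_along_line[OF assms(2)])
  then show ?thesis by auto
qed

text \<open>Two applications of the mean value theorem: first in direction \<open>u\<close> to a
  difference of translates of \<open>f\<close>, then in direction \<open>v\<close> to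
  \<open>D f _ u\<close>.\<close>

lemma second_difference:
  fixes f :: "'a::euclidean_space \<Rightarrow> real"
  assumes "smooth_on S f" "t > 0"
    and S: "\<And>a b. 0 \<le> a \<Longrightarrow> a \<le> t \<Longrightarrow> 0 \<le> b \<Longrightarrow> b \<le> t \<Longrightarrow> x + a *\<^sub>R u + b *\<^sub>R v \<in> S"
  shows "\<exists>a b. 0 < a \<and> a < t \<and> 0 < b \<and> b < t \<and>
    f (x + t *\<^sub>R u + t *\<^sub>R v) - f (x + t *\<^sub>R u) - f (x + t *\<^sub>R v) + f x =
      t * (t * D (\<lambda>y. D f y u) (x + a *\<^sub>R u + b *\<^sub>R v) v)"
proof -
  have d: "f differentiable (at (x + a *\<^sub>R u + b *\<^sub>R v))"
    if "0 \<le> a" "a \<le> t" "0 \<le> b" "b \<le> t" for a b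
    using S[OF that] smooth_on_differentiable[OF assms(1)] by blast
  \<comment> \<open>The second difference is the increment of \<open>g\<close> from \<open>0\<close>
    to \<open>t\<close>.\<close>
  define g where "g = (\<lambda>z. f (x + t *\<^sub>R v + z *\<^sub>R u) - f (x + z *\<^sub>R u))"
  have dg: "(g has_real_derivative D f (x + t *\<^sub>R v + z *\<^sub>R u) u - D f (x + z *\<^sub>R u) u) (at z)"
    if "0 \<le> z" "z \<le> t" for z
    unfolding g_def
    by (intro DERIV_diff D_along_line)
      (use d[OF that, of t] d[OF that, of 0] assms(2) in \<open>auto simp: algebra_simps\<close>)
  obtain a where a: "0 < a" "a < t"
    "g t - g 0 = (t - 0) * (D f (x + t *\<^sub>R v + a *\<^sub>R u) u - D f (x + a *\<^sub>R u) u)"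
    using MVT2[OF assms(2) dg] by blast
  have "\<exists>b>0. b < t \<and> D f (x + a *\<^sub>R u + t *\<^sub>R v) u - D f (x + a *\<^sub>R u) u =
      t * D (\<lambda>y. D f y u) (x + a *\<^sub>R u + b *\<^sub>R v) v"
    by (rule mvt_along_line[OF assms(2)])
      (use a smooth_on_differentiable[OF smooth_on_D[OF assms(1)] S] in auto)
  then obtain b where "0 < b" "b < t" "D f (x + a *\<^sub>R u + t *\<^sub>R v) u - D f (x + a *\<^sub>R u) u =
      t * D (\<lambda>y. D f y u) (x + a *\<^sub>R u + b *\<^sub>R v) v" by blast
  moreover have "g t - g 0 = f (x + t *\<^sub>R u + t *\<^sub>R v) - f (x + t *\<^sub>R u) - f (x + t *\<^sub>R v) + f x"
    by (simp add: g_def algebra_simps)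
  moreover have "x + t *\<^sub>R v + a *\<^sub>R u = x + a *\<^sub>R u + t *\<^sub>R v" by simp
  ultimately have "f (x + t *\<^sub>R u + t *\<^sub>R v) - f (x + t *\<^sub>R u) - f (x + t *\<^sub>R v) + f x =
      t * (t * D (\<lambda>y. D f y u) (x + a *\<^sub>R u + b *\<^sub>R v) v)"
    using a(3) by simp
  with a(1,2) \<open>0 < b\<close> \<open>b < t\<close> show ?thesis by blast
qed

text \<open>The second difference is symmetric in \<open>u\<close> and \<open>v\<close>, so it
  equals \<open>t * t\<close> times a value of either mixed derivative at some point near
  \<open>x\<close>. If the two differed at \<open>x\<close>, their continuity would give a
  contradiction for small \<open>t\<close>.\<close>

lemma D_commute_real:
  fixes f :: "'a::euclidean_space \<Rightarrow> real"
  assumes "open S" "x \<in> S" "smooth_on S f"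
  shows "D (\<lambda>y. D f y u) x v = D (\<lambda>y. D f y v) x u"
proof (rule ccontr)
  define A where "A = (\<lambda>y. D (\<lambda>y. D f y u) y v)"
  define B where "B = (\<lambda>y. D (\<lambda>y. D f y v) y u)"
  assume "D (\<lambda>y. D f y u) x v \<noteq> D (\<lambda>y. D f y v) x u"
  then have e: "dist (A x) (B x) / 2 > 0" by (simp add: A_def B_def)
  have "isCont A x" "isCont B x"
    using smooth_on_continuous[OF smooth_on_D[OF smooth_on_D[OF assms(3)]]]
      continuous_on_eq_continuous_at[OF assms(1)] assms(2) unfolding A_def B_def by blast+
  then obtain d1 d2 where d12: "d1 > 0" "d2 > 0"
    "\<And>y. dist y x < d1 \<Longrightarrow> dist (A y) (A x) < dist (A x) (B x) / 2"
    "\<And>y. dist y x < d2 \<Longrightarrow> dist (B y) (B x) < dist (A x) (B x) / 2"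
    using e continuous_at_eps_delta[of x A] continuous_at_eps_delta[of x B] by metis
  obtain d3 where d3: "d3 > 0" "\<And>y. dist y x < d3 \<Longrightarrow> y \<in> S"
    using assms(1,2) unfolding open_dist by blast
  define d where "d = min d1 (min d2 d3)"
  \<comment> \<open>This size keeps both parallelograms spanned from \<open>x\<close> within
    distance \<open>d\<close>; the summand \<open>1\<close> makes the denominator positive and the
    estimate strict.\<close>
  define t where "t = d / (norm u + norm v + 1)"
  have "d > 0" using d12 d3 by (simp add: d_def)
  have pos: "norm u + norm v + 1 > 0" by (simp add: add_nonneg_pos)
  have t: "t > 0" using \<open>d > 0\<close> pos by (simp add: t_def)
  have near: "dist (x + a *\<^sub>R u + b *\<^sub>R v) x < d" if "0 \<le> a" "a \<le> t" "0 \<le> b" "b \<le> t" for a b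
  proof -
    have "dist (x + a *\<^sub>R u + b *\<^sub>R v) x = norm (a *\<^sub>R u + b *\<^sub>R v)"
      by (simp add: dist_norm)
    also have "\<dots> \<le> a * norm u + b * norm v"
      using norm_triangle_ineq[of "a *\<^sub>R u" "b *\<^sub>R v"] that by simp
    also have "\<dots> \<le> t * norm u + t * norm v"
      using that by (intro add_mono mult_right_mono) auto
    also have "\<dots> < t * (norm u + norm v + 1)" using t by (simp add: algebra_simps)
    also have "\<dots> = d" using pos by (simp add: t_def)
    finally show ?thesis .
  qed
  have near': "dist (x + a *\<^sub>R v + b *\<^sub>R u) x < d" if "0 \<le> a" "a \<le> t" "0 \<le> b" "b \<le> t" for a b
    using near[OF that(3,4,1,2)] by (simp add: algebra_simps)
  obtain a b where ab: "0 < a" "a < t" "0 < b" "b < t"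
    "f (x + t *\<^sub>R u + t *\<^sub>R v) - f (x + t *\<^sub>R u) - f (x + t *\<^sub>R v) + f x =
      t * (t * A (x + a *\<^sub>R u + b *\<^sub>R v))"
    using second_difference[OF assms(3) t, of x u v] near d3 unfolding A_def d_def by force
  obtain a' b' where ab': "0 < a'" "a' < t" "0 < b'" "b' < t"
    "f (x + t *\<^sub>R v + t *\<^sub>R u) - f (x + t *\<^sub>R v) - f (x + t *\<^sub>R u) + f x =
      t * (t * B (x + a' *\<^sub>R v + b' *\<^sub>R u))"
    using second_difference[OF assms(3) t, of x v u] near' d3 unfolding B_def d_def by force
  have comm: "x + t *\<^sub>R v + t *\<^sub>R u = x + t *\<^sub>R u + t *\<^sub>R v" by simp
  have "t * (t * A (x + a *\<^sub>R u + b *\<^sub>R v)) = t * (t * B (x + a' *\<^sub>R v + b' *\<^sub>R u))"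
    using ab(5) ab'(5) unfolding comm by linarith
  then have eq: "A (x + a *\<^sub>R u + b *\<^sub>R v) = B (x + a' *\<^sub>R v + b' *\<^sub>R u)" using t by simp
  have "dist (A (x + a *\<^sub>R u + b *\<^sub>R v)) (A x) < dist (A x) (B x) / 2"
    using near[of a b] ab d12(3) by (simp add: d_def)
  moreover have "dist (A (x + a *\<^sub>R u + b *\<^sub>R v)) (B x) < dist (A x) (B x) / 2"
    unfolding eq using near'[of a' b'] ab' d12(4) by (simp add: d_def)
  ultimately show False
    using dist_triangle_half_l[of "A x" "A (x + a *\<^sub>R u + b *\<^sub>R v)" "dist (A x) (B x)" "B x"]
    by (simp add: dist_commute)
qed

lemma D_commute:
  fixes f :: "'a::euclidean_space \<Rightarrow> 'b::euclidean_space"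
  assumes "open S" "x \<in> S" "smooth_on S f"
  shows "D (\<lambda>y. D f y u) x v = D (\<lambda>y. D f y v) x u"
proof (rule euclidean_eqI)
  fix b :: 'b assume "b \<in> Basis"
  have D2: "D (\<lambda>y. D (\<lambda>z. f z \<bullet> b) y u) x v = D (\<lambda>y. D f y u) x v \<bullet> b" for u v
  proof -
    have 1: "D (\<lambda>z. f z \<bullet> b) y u = D f y u \<bullet> b" if "y \<in> S" for y
      by (rule D_bounded_linear[OF bounded_linear_inner_left
            smooth_on_differentiable[OF assms(3) that]])
    have diff: "(\<lambda>y. D f y u) differentiable (at x)"
      by (rule smooth_on_differentiable[OF smooth_on_D[OF assms(3)] assms(2)])
    have "(\<lambda>y. D (\<lambda>z. f z \<bullet> b) y u) differentiable (at x)"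
      by (rule smooth_on_differentiable[OF smooth_on_D[OF
            smooth_on_linear[OF bounded_linear_inner_left assms(1,3)]] assms(2)])
    then have "D (\<lambda>y. D (\<lambda>z. f z \<bullet> b) y u) x v = D (\<lambda>y. D f y u \<bullet> b) x v"
      using D_cong[OF assms(1,2), of "\<lambda>y. D (\<lambda>z. f z \<bullet> b) y u" "\<lambda>y. D f y u \<bullet> b" v] 1 by simp
    also have "\<dots> = D (\<lambda>y. D f y u) x v \<bullet> b"
      by (rule D_bounded_linear[OF bounded_linear_inner_left diff])
    finally show ?thesis .
  qed
  show "D (\<lambda>y. D f y u) x v \<bullet> b = D (\<lambda>y. D f y v) x u \<bullet> b"
    using D2 D_commute_real[OF assms(1,2)
        smooth_on_linear[OF bounded_linear_inner_left assms(1,3)], of b u v] by simp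
qed

section \<open>Linear algebra\<close>

text \<open>The range is a subspace of the hyperplane orthogonal to \<open>\<nu>\<close> and has the
  same dimension, so the two coincide.\<close>

lemma in_range_iff_orthogonal:
  fixes L :: "'a::euclidean_space \<Rightarrow> 'v::euclidean_space"
  assumes "linear L" "inj L" "DIM('v) = DIM('a) + 1" "\<nu> \<noteq> 0" "\<And>u. \<nu> \<bullet> L u = 0"
  shows "w \<in> range L \<longleftrightarrow> \<nu> \<bullet> w = 0"
proof -
  have sub: "subspace (range L)" by (rule linear_subspace_image[OF assms(1) subspace_UNIV])
  have "dim (range L) = DIM('a)" by (simp add: dim_image_eq assms)
  moreover have "dim {y. \<nu> \<bullet> y = 0} = DIM('v) - 1" by (rule dim_hyperplane[OF assms(4)])
  moreover have "range L \<subseteq> {y. \<nu> \<bullet> y = 0}" using assms(5) by auto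
  ultimately have "range L = {y. \<nu> \<bullet> y = 0}"
    by (intro subspace_dim_equal sub subspace_hyperplane) (use assms(3) in auto)
  then show ?thesis by blast
qed

text \<open>Two candidates differ by a vector that lies both in \<open>T\<close> and in its
  orthogonal complement; hence the description in \<open>normal_part\<close> is unique.\<close>

lemma normal_part_eqI:
  assumes "subspace T" "\<nu> \<in> orthogonal_comp T" "w - \<nu> \<in> T"
  shows "normal_part T w = \<nu>"
  unfolding normal_part_def
proof (rule the_equality)
  fix \<mu> assume \<mu>: "\<mu> \<in> orthogonal_comp T \<and> w - \<mu> \<in> T"
  have "(w - \<nu>) - (w - \<mu>) \<in> T" by (rule subspace_diff[OF assms(1)]) (use assms \<mu> in auto)
  then have "\<mu> - \<nu> \<in> T" by simp
  moreover have "\<mu> - \<nu> \<in> orthogonal_comp T"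
    by (rule subspace_diff[OF subspace_orthogonal_comp]) (use assms \<mu> in auto)
  ultimately have "orthogonal (\<mu> - \<nu>) (\<mu> - \<nu>)" by (auto simp: orthogonal_comp_def)
  then show "\<mu> = \<nu>" by (simp add: orthogonal_self)
qed (use assms in auto)

text \<open>The forward direction rests on the existence of an orthogonal decomposition: it
  guarantees that the description in \<open>normal_part\<close> denotes an actual normal
  component.\<close>

lemma normal_part_eq_0_iff:
  fixes T :: "'v::euclidean_space set"
  assumes "subspace T"
  shows "normal_part T w = 0 \<longleftrightarrow> w \<in> T"
proof
  assume "w \<in> T"
  then show "normal_part T w = 0"
    by (intro normal_part_eqI[OF assms]) (auto simp: subspace_0 subspace_orthogonal_comp)
next
  assume "normal_part T w = 0"
  obtain y z where yz: "y \<in> span T" "\<And>x. x \<in> span T \<Longrightarrow> orthogonal z x" "w = y + z"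
    using orthogonal_subspace_decomp_exists[of T w] by blast
  have "y \<in> T" "z \<in> orthogonal_comp T"
    using yz assms span_base by (auto simp: orthogonal_comp_def span_eq_iff[THEN iffD2, OF assms] orthogonal_commute)
  then have "normal_part T w = z" using yz by (intro normal_part_eqI[OF assms]) auto
  then show "w \<in> T" using \<open>normal_part T w = 0\<close> \<open>y \<in> T\<close> yz(3) by simp
qed

section \<open>Local theory in a chart\<close>

lemma D_split:
  fixes f :: "'e::euclidean_space \<times> real \<Rightarrow> 'v::real_normed_vector"
  assumes "f differentiable (at x)"
  shows "D f x (u, a) = D f x (u, 0) + a *\<^sub>R D f x (0, 1)"
proof -
  interpret linear "D f x" by (rule D_linear[OF assms])
  have "(u, a) = (u, 0) + a *\<^sub>R (0, 1)" by simp
  then show ?thesis by (metis add scale)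
qed

lemma injective_ds_nz:
  fixes L :: "'e::euclidean_space \<times> real \<Rightarrow> 'v::real_vector"
  assumes "linear L" "inj L"
  shows "L (0, 1) \<noteq> 0"
proof
  assume "L (0, 1) = 0"
  then have "L (0, 1) = L 0" using linear_0[OF assms(1)] by simp
  then have "(0::'e, 1::real) = 0" by (rule injD[OF assms(2)])
  then show False by (simp add: zero_prod_def)
qed

text \<open>The coordinate expression \<open>n\<close> of the Gauss map in one product chart.
  Direction \<open>(u, 0)\<close> is tangent to \<open>E0\<close> and \<open>(0, 1)\<close> is
  \<partial>_s; injectivity and the dimension condition make the range of \<open>D n x\<close> the
  whole tangent space of the sphere at \<open>n x\<close>.\<close>

locale spherical_chart =
  fixes S :: "('e::euclidean_space \<times> real) set" and n :: "'e \<times> real \<Rightarrow> 'v::euclidean_space"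
  assumes open_S: "open S" and smooth_n: "smooth_on S n"
    and norm_n: "x \<in> S \<Longrightarrow> norm (n x) = 1"
    and inj_n: "x \<in> S \<Longrightarrow> inj (D n x)"
    and dim: "DIM('v) = DIM('e \<times> real) + 1"
begin

text \<open>Coordinate forms of \<open>N\<^sub>* \<partial>\<^sub>s\<close>, of its length and of
  the unit field in its direction.\<close>

definition "n_s x = D n x (0, 1)"
definition "rho x = norm (n_s x)"
definition "e x = inverse (rho x) *\<^sub>R n_s x"

lemma n_diff: "x \<in> S \<Longrightarrow> n differentiable (at x)"
  by (rule smooth_on_differentiable[OF smooth_n])

lemma n_n: "x \<in> S \<Longrightarrow> n x \<bullet> n x = 1"
  using norm_n by (simp add: dot_square_norm)

lemma n_Dn: "x \<in> S \<Longrightarrow> n x \<bullet> D n x v = 0"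
  using D_inner_const[OF open_S _ smooth_n smooth_n n_n, of x v] by (simp add: inner_commute)

lemma n_nz: "x \<in> S \<Longrightarrow> n x \<noteq> 0"
  using n_n[of x] by auto

lemma n_s_nz: "x \<in> S \<Longrightarrow> n_s x \<noteq> 0"
  unfolding n_s_def by (intro injective_ds_nz D_linear n_diff inj_n)

lemma rho_pos: "x \<in> S \<Longrightarrow> 0 < rho x"
  using n_s_nz by (simp add: rho_def)

lemma smooth_n_s: "smooth_on S n_s"
  unfolding n_s_def[abs_def] by (rule smooth_on_D[OF smooth_n])

lemma smooth_rho: "smooth_on S rho"
  unfolding rho_def[abs_def] by (rule smooth_on_norm[OF open_S smooth_n_s n_s_nz])

lemma smooth_e: "smooth_on S e"
  unfolding e_def[abs_def]
  by (intro smooth_on_scaleR smooth_on_inverse smooth_rho smooth_n_s open_S) (use rho_pos in force)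

lemma e_diff: "x \<in> S \<Longrightarrow> e differentiable (at x)"
  by (rule smooth_on_differentiable[OF smooth_e])

lemma n_s_eq: "x \<in> S \<Longrightarrow> n_s x = rho x *\<^sub>R e x"
  using rho_pos[of x] by (simp add: e_def)

lemma n_e: "x \<in> S \<Longrightarrow> n x \<bullet> e x = 0"
  using n_Dn[of x "(0, 1)"] by (simp add: e_def n_s_def)

lemma e_e: "x \<in> S \<Longrightarrow> e x \<bullet> e x = 1"
  using rho_pos[of x] by (simp add: e_def rho_def dot_square_norm power2_eq_square field_simps)

lemma e_De: "x \<in> S \<Longrightarrow> e x \<bullet> D e x v = 0"
  using D_inner_const[OF open_S _ smooth_e smooth_e e_e, of x v] by (simp add: inner_commute)

lemma n_De: "x \<in> S \<Longrightarrow> n x \<bullet> D e x v = - (D n x v \<bullet> e x)"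
  using D_inner_const[OF open_S _ smooth_n smooth_e n_e, of x v] .

lemma range_Dn: "x \<in> S \<Longrightarrow> w \<in> range (D n x) \<longleftrightarrow> n x \<bullet> w = 0"
  by (rule in_range_iff_orthogonal[OF D_linear[OF n_diff] inj_n dim n_nz n_Dn])

end

section \<open>The orthogonal splitting by \<open>n\<close>, \<open>e\<close> and the image of
  \<open>E0\<close>\<close>

locale orthogonal_chart = spherical_chart +
  assumes orth: "x \<in> S \<Longrightarrow> D n x (u, 0) \<bullet> D n x (0, 1) = 0"
begin

lemma e_Dn: "x \<in> S \<Longrightarrow> e x \<bullet> D n x (u, 0) = 0"
  using orth[of x u] by (simp add: e_def n_s_def inner_commute)

lemma e_Dn1: "x \<in> S \<Longrightarrow> e x \<bullet> D n x (0, 1) = rho x"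
  using n_s_eq[of x] e_e[of x] by (simp add: n_s_def)

text \<open>Orthogonality to \<open>n\<close> puts \<open>w\<close> into the range of
  \<open>D n x\<close>, so \<open>w\<close> is the sum of an image of \<open>E0\<close> and a
  multiple of \<open>e\<close>. Being orthogonal to both summands, it is orthogonal to
  itself.\<close>

lemma vanishI:
  assumes "x \<in> S" "n x \<bullet> w = 0" "e x \<bullet> w = 0" "\<And>u. D n x (u, 0) \<bullet> w = 0"
  shows "w = 0"
proof -
  obtain u a where "w = D n x (u, a)" using range_Dn[OF assms(1), of w] assms(2) by auto
  then have "w = D n x (u, 0) + a *\<^sub>R (rho x *\<^sub>R e x)"
    using D_split[OF n_diff[OF assms(1)]] n_s_eq[OF assms(1)] n_s_def by metis
  then have "w \<bullet> w = 0" using assms(3,4) by (metis add_0 inner_add_left inner_scaleR_left mult_zero_right)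
  then show ?thesis by simp
qed

text \<open>Serves both directions: \<open>G\<close>, \<open>A\<close>, \<open>B\<close> will be the
  coordinate forms of \<gamma>, \<alpha>, \<beta>, and \<open>F\<close> that of the
  hypersurface.\<close>

lemma D_combination:
  assumes x: "x \<in> S" and G: "smooth_on S G" and A: "smooth_on S A" and B: "smooth_on S B"
    and F: "\<And>x. x \<in> S \<Longrightarrow> F x = G x + A x *\<^sub>R n x + B x *\<^sub>R e x"
  shows "D F x v = D G x v + (A x *\<^sub>R D n x v + D A x v *\<^sub>R n x) + (B x *\<^sub>R D e x v + D B x v *\<^sub>R e x)"
proof -
  let ?F = "\<lambda>x. G x + A x *\<^sub>R n x + B x *\<^sub>R e x"
  have sAn: "smooth_on S (\<lambda>x. A x *\<^sub>R n x)" and sBe: "smooth_on S (\<lambda>x. B x *\<^sub>R e x)"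
    by (intro smooth_on_scaleR open_S A B smooth_n smooth_e)+
  have sGAn: "smooth_on S (\<lambda>x. G x + A x *\<^sub>R n x)"
    by (intro smooth_on_add open_S G sAn)
  have "smooth_on S ?F"
    by (intro smooth_on_add open_S sGAn sBe)
  note d = smooth_on_differentiable[OF _ x]
  have "D F x v = D ?F x v"
    using D_cong[OF open_S x, of ?F F v] F d[OF \<open>smooth_on S ?F\<close>] by simp
  then show ?thesis
    by (simp add: D_add[OF d[OF sGAn] d[OF sBe]] D_add[OF d[OF G] d[OF sAn]]
        D_scaleR[OF d[OF A] n_diff[OF x]] D_scaleR[OF d[OF B] e_diff[OF x]])
qed

text \<open>The right-hand side is the defect in the compatibility equation. That equation is
  therefore equivalent to the orthogonality of \<partial>_s-derivative of \<open>F\<close> and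
  \<open>n\<close>, and this identity is read in one direction for each half of the theorem.\<close>

lemma n_D_combination:
  assumes "x \<in> S" "smooth_on S G" "smooth_on S A" "smooth_on S B"
    "\<And>x. x \<in> S \<Longrightarrow> F x = G x + A x *\<^sub>R n x + B x *\<^sub>R e x"
  shows "n x \<bullet> D F x (0, 1) = D G x (0, 1) \<bullet> n x + D A x (0, 1) - B x * rho x"
proof -
  have "n x \<bullet> D e x (0, 1) = - rho x"
    using n_De[OF assms(1)] e_Dn1[OF assms(1)] by (simp add: inner_commute)
  then show ?thesis
    by (simp add: D_combination[OF assms(1-4), where F = F, OF assms(5)] inner_add_right n_Dn[OF assms(1)] n_n[OF assms(1)] n_e[OF assms(1)]
        inner_commute[of "D G x (0, 1)"])
qed

end

text \<open>The data of the direct statement in one chart. That \<open>G\<close>, \<open>A\<close>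
  and \<open>B\<close> depend on \<open>s\<close> alone is encoded by their vanishing derivatives
  along \<open>E0\<close>.\<close>

locale enneper_chart = orthogonal_chart +
  fixes G F :: "'a \<times> real \<Rightarrow> 'b" and A B :: "'a \<times> real \<Rightarrow> real"
  assumes smooth_G: "smooth_on S G" and smooth_A: "smooth_on S A" and smooth_B: "smooth_on S B"
    and F_eq: "x \<in> S \<Longrightarrow> F x = G x + A x *\<^sub>R n x + B x *\<^sub>R e x"
    and DG_0: "x \<in> S \<Longrightarrow> D G x (u, 0) = 0"
    and DA_0: "x \<in> S \<Longrightarrow> D A x (u, 0) = 0"
    and DB_0: "x \<in> S \<Longrightarrow> D B x (u, 0) = 0"
    and compat: "x \<in> S \<Longrightarrow> D G x (0, 1) \<bullet> n x + D A x (0, 1) = B x * rho x"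
begin

lemma smooth_F: "smooth_on S F"
  by (rule smooth_on_cong[of S "\<lambda>x. G x + A x *\<^sub>R n x + B x *\<^sub>R e x"])
    (auto intro!: smooth_on_add smooth_on_scaleR open_S smooth_G smooth_A smooth_B smooth_n smooth_e
      simp: F_eq)

lemma F_diff: "x \<in> S \<Longrightarrow> F differentiable (at x)"
  by (rule smooth_on_differentiable[OF smooth_F])

lemmas D_F = D_combination[OF _ smooth_G smooth_A smooth_B F_eq]

lemma DF_0: "x \<in> S \<Longrightarrow> D F x (u, 0) = A x *\<^sub>R D n x (u, 0) + B x *\<^sub>R D e x (u, 0)"
  by (simp add: D_F DG_0 DA_0 DB_0)

lemma n_DF_0: "x \<in> S \<Longrightarrow> n x \<bullet> D F x (u, 0) = 0"
  by (simp add: DF_0 inner_add_right n_Dn n_De e_Dn inner_commute[of "D n x (u, 0)"])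

text \<open>Along \<open>E0\<close> the component is zero by \<open>n_DF_0\<close>; along
  \<partial>_s it is the expression in \<open>n_D_combination\<close>, which \<open>compat\<close>
  makes vanish.\<close>

lemma n_DF: "x \<in> S \<Longrightarrow> n x \<bullet> D F x v = 0"
  using D_split[OF F_diff, of x "fst v" "snd v"] compat[of x] n_DF_0[of x]
    n_D_combination[OF _ smooth_G smooth_A smooth_B F_eq, of x]
  by (simp add: inner_add_right)

lemma e_DF_0: "x \<in> S \<Longrightarrow> e x \<bullet> D F x (u, 0) = 0"
  by (simp add: DF_0 inner_add_right e_Dn e_De)

text \<open>The derivative of the compatibility equation along \<open>E0\<close>. Only
  \<open>n\<close> contributes on the left and only \<open>rho\<close> on the right.\<close>

lemma DG_Dn:
  assumes "x \<in> S"
  shows "D G x (0, 1) \<bullet> D n x (u, 0) = B x * D rho x (u, 0)"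
proof -
  note d = smooth_on_differentiable[OF _ assms]
  have sG1: "smooth_on S (\<lambda>x. D G x (0, 1))" and sA1: "smooth_on S (\<lambda>x. D A x (0, 1))"
    by (intro smooth_on_D smooth_G smooth_A)+
  have s1: "smooth_on S (\<lambda>x. D G x (0, 1) \<bullet> n x)"
    by (intro smooth_on_inner sG1 smooth_n open_S)
  \<comment> \<open>By symmetry of second derivatives, the \<partial>_s-derivatives of
    \<open>G\<close> and \<open>A\<close> are again stationary along \<open>E0\<close>.\<close>
  have "D (\<lambda>x. D G x (u, 0)) x (0, 1) = 0" "D (\<lambda>x. D A x (u, 0)) x (0, 1) = 0"
    by (rule D_locally_const[OF open_S assms]; simp add: DG_0 DA_0)+
  then have G10: "D (\<lambda>x. D G x (0, 1)) x (u, 0) = 0" and A10: "D (\<lambda>x. D A x (0, 1)) x (u, 0) = 0"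
    using D_commute[OF open_S assms smooth_G, of "(0, 1)" "(u, 0)"]
      D_commute[OF open_S assms smooth_A, of "(0, 1)" "(u, 0)"] by simp_all
  have "D (\<lambda>x. D G x (0, 1) \<bullet> n x + D A x (0, 1)) x (u, 0) = D G x (0, 1) \<bullet> D n x (u, 0)"
    using D_add[OF d[OF s1] d[OF sA1]] D_inner[OF d[OF sG1] d[OF smooth_n]] G10 A10 by simp
  moreover have "D (\<lambda>x. B x * rho x) x (u, 0) = B x * D rho x (u, 0)"
    using D_bilinear[OF bounded_bilinear_mult d[OF smooth_B] d[OF smooth_rho]] DB_0[OF assms] by simp
  moreover have "D (\<lambda>x. D G x (0, 1) \<bullet> n x + D A x (0, 1)) x (u, 0) = D (\<lambda>x. B x * rho x) x (u, 0)"
    by (rule D_cong[OF open_S assms compat d[OF smooth_on_add[OF open_S s1 sA1]]])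
  ultimately show ?thesis by simp
qed

text \<open>The derivative is moved from \<open>e\<close> to the image of \<open>E0\<close>, the
  order of differentiation is exchanged, and \<open>rho x *\<^sub>R e x\<close> is differentiated
  along \<open>E0\<close>; since \<open>e\<close> is a unit field, only the derivative of
  \<open>rho\<close> survives the product with \<open>e\<close>.\<close>

lemma De1_Dn:
  assumes "x \<in> S"
  shows "D e x (0, 1) \<bullet> D n x (u, 0) = - D rho x (u, 0)"
proof -
  note d = smooth_on_differentiable[OF _ assms]
  have "D e x (0, 1) \<bullet> D n x (u, 0) = - (e x \<bullet> D (\<lambda>y. D n y (u, 0)) x (0, 1))"
    using D_inner_const[OF open_S assms smooth_e smooth_on_D[OF smooth_n] e_Dn] by simp
  also have "D (\<lambda>y. D n y (u, 0)) x (0, 1) = D (\<lambda>y. D n y (0, 1)) x (u, 0)"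
    by (rule D_commute[OF open_S assms smooth_n])
  also have "\<dots> = D (\<lambda>y. rho y *\<^sub>R e y) x (u, 0)"
    using D_cong[OF open_S assms, of "\<lambda>y. D n y (0, 1)" "\<lambda>y. rho y *\<^sub>R e y"]
      d[OF smooth_on_D[OF smooth_n]] n_s_eq unfolding n_s_def by simp
  also have "\<dots> = rho x *\<^sub>R D e x (u, 0) + D rho x (u, 0) *\<^sub>R e x"
    by (rule D_scaleR[OF d[OF smooth_rho] d[OF smooth_e]])
  finally show ?thesis using e_De[OF assms] e_e[OF assms] by (simp add: inner_add_right)
qed

text \<open>The terms containing the derivative of \<open>rho\<close>, one from \<open>G\<close> and
  one from \<open>B x *\<^sub>R e x\<close>, cancel.\<close>

lemma Dn_DF1:
  assumes "x \<in> S"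
  shows "D n x (u, 0) \<bullet> D F x (0, 1) = 0"
proof -
  have "D n x (u, 0) \<bullet> D n x (0, 1) = 0" "D n x (u, 0) \<bullet> n x = 0" "D n x (u, 0) \<bullet> e x = 0"
    using orth[OF assms, of u] n_Dn[OF assms, of "(u, 0)"] e_Dn[OF assms, of u]
    by (simp_all add: inner_commute)
  moreover have "D n x (u, 0) \<bullet> D G x (0, 1) = B x * D rho x (u, 0)"
    "D n x (u, 0) \<bullet> D e x (0, 1) = - D rho x (u, 0)"
    using DG_Dn[OF assms] De1_Dn[OF assms] by (simp_all add: inner_commute)
  ultimately show ?thesis by (simp add: D_F[OF assms] inner_add_right)
qed

lemma DF1_eq:
  assumes "x \<in> S"
  shows "D F x (0, 1) = (e x \<bullet> D F x (0, 1)) *\<^sub>R e x"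
proof -
  have "D n x (u, 0) \<bullet> e x = 0" for u using e_Dn[OF assms] by (simp add: inner_commute)
  then have "D F x (0, 1) - (e x \<bullet> D F x (0, 1)) *\<^sub>R e x = 0"
    using n_DF[OF assms] n_e[OF assms] e_e[OF assms] Dn_DF1[OF assms]
    by (intro vanishI[OF assms]) (simp_all add: inner_diff_right)
  then show ?thesis by simp
qed

lemma DF_orth:
  assumes "x \<in> S"
  shows "D F x (u, 0) \<bullet> D F x (0, 1) = 0"
proof -
  have "D F x (u, 0) \<bullet> D F x (0, 1) = D F x (u, 0) \<bullet> ((e x \<bullet> D F x (0, 1)) *\<^sub>R e x)"
    using DF1_eq[OF assms] by simp
  then show ?thesis using e_DF_0[OF assms] by (simp add: inner_commute)
qed

text \<open>Moving the derivative from the field \<open>D F y (Y y)\<close> to \<open>n\<close>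
  leaves the product of an image of \<open>E0\<close> under \<open>D n x\<close> with a multiple of
  \<open>D F x (0, 1)\<close>, which is zero by \<open>Dn_DF1\<close>. At a point where
  \<open>F\<close> is an immersion, tangency to \<open>F\<close> means orthogonality to
  \<open>n\<close>.\<close>

lemma adapted:
  assumes "x \<in> S" "inj (D F x)" "smooth_on S Y" "fst (Y x) = 0"
  shows "D (\<lambda>y. D F y (Y y)) x (u, 0) \<in> range (D F x)"
proof -
  have "n x \<bullet> D (\<lambda>y. D F y (Y y)) x (u, 0) = - (D n x (u, 0) \<bullet> D F x (Y x))"
    by (rule D_inner_const[OF open_S assms(1) smooth_n smooth_on_D_field[OF open_S smooth_F assms(3)] n_DF])
  also have "D F x (Y x) = D F x (0, 0) + snd (Y x) *\<^sub>R D F x (0, 1)"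
    using D_split[OF F_diff[OF assms(1)], of 0 "snd (Y x)"] assms(4) by (metis prod.collapse)
  also have "D F x (0, 0) = 0"
    using linear_0[OF D_linear[OF F_diff[OF assms(1)]]] by (simp add: zero_prod_def)
  finally have "n x \<bullet> D (\<lambda>y. D F y (Y y)) x (u, 0) = 0" using Dn_DF1[OF assms(1)] by simp
  then show ?thesis
    using in_range_iff_orthogonal[OF D_linear[OF F_diff[OF assms(1)]] assms(2) dim n_nz[OF assms(1)] n_DF[OF assms(1)]]
    by simp
qed

text \<open>Ensures a positive radius for every leaf that contains a regular point: if both
  coefficients vanished, \<open>D F x\<close> would annihilate \<open>E0\<close>, which has positive
  dimension.\<close>

lemma regular_nz:
  assumes "x \<in> S" "inj (D F x)"
  shows "A x \<noteq> 0 \<or> B x \<noteq> 0"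
proof (rule ccontr)
  assume "\<not> ?thesis"
  then have "D F x (u, 0) = D F x (0, 0)" for u
    by (simp add: DF_0[OF assms(1)] flip: zero_prod_def)
      (simp add: zero_prod_def linear_0[OF D_linear[OF F_diff[OF assms(1)]]] DF_0[OF assms(1)])
  then have "u = 0" for u :: 'a using injD[OF assms(2)] by blast
  then show False using nonempty_Basis nonzero_Basis by blast
qed

lemma F_G: "x \<in> S \<Longrightarrow> (norm (F x - G x))\<^sup>2 = (A x)\<^sup>2 + (B x)\<^sup>2"
  unfolding power2_norm_eq_inner
  by (simp add: F_eq inner_add_left inner_add_right n_n e_e n_e inner_commute[of "e x" "n x"] power2_eq_square)

end

text \<open>The converse in one chart, without the condition on spheres. Adaptedness is recorded for
  the coordinate fields, in the form that the mixed second derivative of \<open>F\<close> has no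
  component along \<open>n\<close>.\<close>

locale gauss_chart = spherical_chart +
  fixes F :: "'a \<times> real \<Rightarrow> 'b"
  assumes smooth_F: "smooth_on S F"
    and inj_F: "x \<in> S \<Longrightarrow> inj (D F x)"
    and n_DF: "x \<in> S \<Longrightarrow> n x \<bullet> D F x v = 0"
    and F_orth: "x \<in> S \<Longrightarrow> D F x (u, 0) \<bullet> D F x (0, 1) = 0"
    and F_adapted: "x \<in> S \<Longrightarrow> n x \<bullet> D (\<lambda>y. D F y (0, 1)) x (u, 0) = 0"
begin

lemma F_diff: "x \<in> S \<Longrightarrow> F differentiable (at x)"
  by (rule smooth_on_differentiable[OF smooth_F])

lemma range_DF: "x \<in> S \<Longrightarrow> w \<in> range (D F x) \<longleftrightarrow> n x \<bullet> w = 0"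
  by (rule in_range_iff_orthogonal[OF D_linear[OF F_diff] inj_F dim n_nz n_DF])

lemma DF1_nz: "x \<in> S \<Longrightarrow> D F x (0, 1) \<noteq> 0"
  by (intro injective_ds_nz D_linear F_diff inj_F)

text \<open>This and the next identity are the two Weingarten forms of the vanishing mixed second
  fundamental form; the second one also uses the symmetry of second derivatives.\<close>

lemma Dn_DF1: "x \<in> S \<Longrightarrow> D n x (u, 0) \<bullet> D F x (0, 1) = 0"
  using D_inner_const[OF open_S _ smooth_n smooth_on_D[OF smooth_F] n_DF, of x "(0, 1)" "(u, 0)"]
    F_adapted[of x u] by simp

lemma Dn1_DF: "x \<in> S \<Longrightarrow> D n x (0, 1) \<bullet> D F x (u, 0) = 0"
  using D_inner_const[OF open_S _ smooth_n smooth_on_D[OF smooth_F] n_DF, of x "(u, 0)" "(0, 1)"]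
    F_adapted[of x u] D_commute[OF open_S _ smooth_F, of x "(u, 0)" "(0, 1)"] by simp

text \<open>Both \<open>F\<^sub>* E\<^sub>0\<close> and \<open>n\<^sub>* E\<^sub>0\<close> are the orthogonal complement of \<open>n\<close> and \<open>F\<^sub>* \<partial>\<^sub>s\<close>.\<close>

lemma Dn_eq_DF:
  assumes "x \<in> S"
  shows "\<exists>v. D n x (u, 0) = D F x (v, 0)"
proof -
  obtain v a where va: "D n x (u, 0) = D F x (v, a)"
    using range_DF[OF assms, of "D n x (u, 0)"] n_Dn[OF assms] by auto
  then have eq: "D n x (u, 0) = D F x (v, 0) + a *\<^sub>R D F x (0, 1)"
    using D_split[OF F_diff[OF assms]] by metis
  \<comment> \<open>Pairing with \<open>D F x (0, 1)\<close> isolates the \<partial>_s-component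
    \<open>a\<close>.\<close>
  have "a * (D F x (0, 1) \<bullet> D F x (0, 1)) = 0"
    using Dn_DF1[OF assms, of u] F_orth[OF assms, of v] unfolding eq by (simp add: inner_add_left)
  then have "a = 0" using DF1_nz[OF assms] by simp
  then show ?thesis using va by blast
qed

text \<open>The Gauss map inherits the orthogonal net: images of \<open>E0\<close> under
  \<open>D n x\<close> are images of \<open>E0\<close> under \<open>D F x\<close>, and these are
  orthogonal to \<open>D n x (0, 1)\<close>.\<close>

sublocale orthogonal_chart
proof unfold_locales
  fix x u assume "x \<in> S"
  then show "D n x (u, 0) \<bullet> D n x (0, 1) = 0"
    using Dn_eq_DF[of x u] Dn1_DF[of x] by (auto simp: inner_commute)
qed

lemma e_DF: "x \<in> S \<Longrightarrow> e x \<bullet> D F x (u, 0) = 0"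
  using Dn1_DF[of x u] by (simp add: e_def n_s_def)

text \<open>The hypothesis is what remains at \<open>x\<close> of the condition that
  \<open>c\<close> is a centre of a sphere containing the leaf. After removal of its components
  along \<open>n\<close> and \<open>e\<close>, the vector \<open>F x - c\<close> satisfies all
  conditions of \<open>vanishI\<close>.\<close>

lemma centre_decomposition:
  assumes x: "x \<in> S" and c: "\<And>u. (F x - c) \<bullet> D F x (u, 0) = 0"
  shows "F x - c = ((F x - c) \<bullet> n x) *\<^sub>R n x + ((F x - c) \<bullet> e x) *\<^sub>R e x"
proof -
  define w where "w = F x - c"
  have "D n x (u, 0) \<bullet> w = 0" for u
    using Dn_eq_DF[OF x, of u] c by (auto simp: w_def inner_commute)
  moreover have "D n x (u, 0) \<bullet> n x = 0" "D n x (u, 0) \<bullet> e x = 0" for u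
    using n_Dn e_Dn x by (auto simp: inner_commute)
  moreover have "e x \<bullet> n x = 0" using n_e[OF x] by (simp add: inner_commute)
  ultimately have "w - ((w \<bullet> n x) *\<^sub>R n x + (w \<bullet> e x) *\<^sub>R e x) = 0"
    by (intro vanishI[OF x])
      (simp_all add: inner_diff_right inner_add_right n_n[OF x] n_e[OF x] e_e[OF x] inner_commute[of w])
  then show ?thesis by (simp add: w_def)
qed

lemma D_shift:
  assumes "x \<in> S" shows "D (\<lambda>y. F y - c) x v = D F x v"
  using D_add[OF F_diff[OF assms], of "\<lambda>_. - c" v] by simp

lemma F_shift_diff: "x \<in> S \<Longrightarrow> (\<lambda>y. F y - c) differentiable (at x)"
  by (intro differentiable_diff F_diff differentiable_const)

lemma D_normal_coefficient:
  assumes x: "x \<in> S" and c: "\<And>u. (F x - c) \<bullet> D F x (u, 0) = 0"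
  shows "D (\<lambda>y. (F y - c) \<bullet> n y) x (u, 0) = 0"
proof -
  have "(F x - c) \<bullet> D n x (u, 0) = 0" using Dn_eq_DF[OF x, of u] c by auto
  then show ?thesis
    using D_inner[OF F_shift_diff[OF x] n_diff[OF x]] n_DF[OF x] by (simp add: D_shift[OF x] inner_commute)
qed

text \<open>Along \<open>E0\<close> the derivative of \<open>e\<close> is orthogonal to
  \<open>n\<close> and to \<open>e\<close>, hence to \<open>F x - c\<close>, which
  \<open>centre_decomposition\<close> places in their span.\<close>

lemma D_tangent_coefficient:
  assumes x: "x \<in> S" and c: "\<And>u. (F x - c) \<bullet> D F x (u, 0) = 0"
  shows "D (\<lambda>y. (F y - c) \<bullet> e y) x (u, 0) = 0"
proof -
  have "n x \<bullet> D e x (u, 0) = 0" "e x \<bullet> D e x (u, 0) = 0"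
    using n_De[OF x] e_Dn[OF x] e_De[OF x] by (simp_all add: inner_commute)
  then have "(a *\<^sub>R n x + b *\<^sub>R e x) \<bullet> D e x (u, 0) = 0" for a b
    by (simp add: inner_add_left)
  then have "(F x - c) \<bullet> D e x (u, 0) = 0"
    using centre_decomposition[OF x c] by metis
  then show ?thesis
    using D_inner[OF F_shift_diff[OF x] e_diff[OF x]] e_DF[OF x] by (simp add: D_shift[OF x] inner_commute)
qed

end

section \<open>Smooth solutions of linear systems\<close>

text \<open>Otherwise \<open>w\<close> together with the frame would be \<open>DIM('v) + 1\<close>
  nonzero, pairwise orthogonal vectors.\<close>

lemma orthogonal_frame_vanish:
  fixes E :: "nat \<Rightarrow> 'v::euclidean_space"
  assumes nz: "\<And>i. i < DIM('v) \<Longrightarrow> E i \<noteq> 0"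
    and orth: "\<And>i j. i < DIM('v) \<Longrightarrow> j < DIM('v) \<Longrightarrow> i \<noteq> j \<Longrightarrow> E i \<bullet> E j = 0"
    and w: "\<And>i. i < DIM('v) \<Longrightarrow> E i \<bullet> w = 0"
  shows "w = 0"
proof (rule ccontr)
  assume "w \<noteq> 0"
  let ?B = "E ` {..<DIM('v)}"
  have "inj_on E {..<DIM('v)}"
    using nz orth by (metis inj_onI inner_eq_zero_iff lessThan_iff)
  then have card: "card ?B = DIM('v)" by (simp add: card_image)
  have "w \<notin> ?B" using w \<open>w \<noteq> 0\<close> by (metis imageE inner_eq_zero_iff lessThan_iff)
  have "pairwise orthogonal (insert w ?B)"
    unfolding pairwise_insert
    using w orth by (auto simp: pairwise_def orthogonal_def inner_commute)
  moreover have "0 \<notin> insert w ?B" using nz \<open>w \<noteq> 0\<close> by (metis imageE insertE lessThan_iff)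
  ultimately have "card (insert w ?B) \<le> DIM('v)"
    using pairwise_orthogonal_independent independent_bound by blast
  then show False using card \<open>w \<notin> ?B\<close> by simp
qed

text \<open>Gram--Schmidt turns the \<open>L i\<close> into smooth orthogonal vectors near \<open>s\<^sub>0\<close> whose inner products
  with \<open>c\<close> are still smooth.\<close>

lemma smooth_orthogonalisation:
  fixes L :: "'i \<Rightarrow> 's::euclidean_space \<Rightarrow> 'v::euclidean_space"
  assumes "open J" "s0 \<in> J"
    and "\<forall>i\<in>K. smooth_on J (L i)" "\<forall>i\<in>K. smooth_on J (\<lambda>s. L i s \<bullet> c s)"
    and spans: "\<forall>a. (\<forall>i\<in>K. a \<bullet> L i s0 = 0) \<longrightarrow> a = 0"
    and "m \<le> DIM('v)"
  shows "\<exists>U E. open U \<and> s0 \<in> U \<and> U \<subseteq> J \<and>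
    (\<forall>i<m. smooth_on U (E i) \<and> smooth_on U (\<lambda>s. E i s \<bullet> c s) \<and> (\<forall>s\<in>U. E i s \<noteq> (0::'v))) \<and>
    (\<forall>i<m. \<forall>j<m. i \<noteq> j \<longrightarrow> (\<forall>s\<in>U. E i s \<bullet> E j s = 0))"
  using assms(6)
proof (induction m)
  case 0
  then show ?case using assms(1,2) by auto
next
  case (Suc m)
  note L = assms(3)[rule_format] and Lc = assms(4)[rule_format]
  from Suc obtain U E where U: "open U" "s0 \<in> U" "U \<subseteq> J"
    and E_all: "\<forall>i<m. smooth_on U (E i) \<and> smooth_on U (\<lambda>s. E i s \<bullet> c s) \<and> (\<forall>s\<in>U. E i s \<noteq> (0::'v))"
    and orth_all: "\<forall>i<m. \<forall>j<m. i \<noteq> j \<longrightarrow> (\<forall>s\<in>U. E i s \<bullet> E j s = 0)"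
    by auto
  have E: "\<And>i. i < m \<Longrightarrow> smooth_on U (E i)" "\<And>i. i < m \<Longrightarrow> smooth_on U (\<lambda>s. E i s \<bullet> c s)"
      "\<And>i s. i < m \<Longrightarrow> s \<in> U \<Longrightarrow> E i s \<noteq> 0"
    using E_all by blast+
  have orth: "\<And>i j s. i < m \<Longrightarrow> j < m \<Longrightarrow> i \<noteq> j \<Longrightarrow> s \<in> U \<Longrightarrow> E i s \<bullet> E j s = 0"
    using orth_all by blast
  let ?B = "(\<lambda>i. E i s0) ` {..<m}"
  have "dim ?B \<le> card ?B" by (rule dim_le_card) (auto intro: span_base)
  also have "\<dots> \<le> m" using card_image_le[of "{..<m}" "\<lambda>i. E i s0"] by simp
  finally have "dim ?B < DIM('v)" using Suc.prems by simp
  then obtain a where a: "a \<noteq> 0" "span ?B \<subseteq> {x. a \<bullet> x = 0}"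
    using lowdim_subset_hyperplane by blast
  then have aE: "a \<bullet> E j s0 = 0" if "j < m" for j
    using that span_superset[of ?B] by auto
  \<comment> \<open>The vectors found so far lie in the hyperplane normal to \<open>a\<close>. Since
    the \<open>L i s0\<close> have no common nonzero normal, one of them leaves this hyperplane and
    can extend the frame.\<close>
  obtain i where i: "i \<in> K" "a \<bullet> L i s0 \<noteq> 0" using spans a(1) by blast
  define q where "q j s = (L i s \<bullet> E j s) * inverse (E j s \<bullet> E j s)" for j s
  define w where "w s = L i s - (\<Sum>j<m. q j s *\<^sub>R E j s)" for s
  have sq: "smooth_on U (q j)" if "j < m" for j
    unfolding q_def[abs_def] using E(1)[OF that] E(3)[OF that] U i(1) L
    by (intro smooth_on_mult smooth_on_inverse smooth_on_inner) (auto intro: smooth_on_subset)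
  have sw: "smooth_on U w"
    unfolding w_def[abs_def] using U(1) E(1) sq smooth_on_subset[OF L[OF i(1)] U(3)]
    by (intro smooth_on_diff smooth_on_sum smooth_on_scaleR) auto
  \<comment> \<open>The product of \<open>w\<close> with \<open>c\<close> is assembled from products
    already known to be smooth; the smoothness of \<open>c\<close> itself is what the construction
    is meant to yield.\<close>
  have "smooth_on U (\<lambda>s. L i s \<bullet> c s - (\<Sum>j<m. q j s * (E j s \<bullet> c s)))"
    using U(1) E(2) sq smooth_on_subset[OF Lc[OF i(1)] U(3)]
    by (intro smooth_on_diff smooth_on_sum smooth_on_mult) auto
  then have swc: "smooth_on U (\<lambda>s. w s \<bullet> c s)"
    by (simp add: w_def inner_diff_left inner_sum_left)
  have worth: "w s \<bullet> E k s = 0" if "k < m" "s \<in> U" for k s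
  proof -
    have "(\<Sum>j<m. q j s * (E j s \<bullet> E k s)) = (\<Sum>j<m. if j = k then q k s * (E k s \<bullet> E k s) else 0)"
      by (rule sum.cong) (use orth that in auto)
    also have "\<dots> = L i s \<bullet> E k s" using that E(3)[OF that] by (simp add: q_def)
    finally show ?thesis by (simp add: w_def inner_diff_left inner_sum_left)
  qed
  have "a \<bullet> w s0 = a \<bullet> L i s0" by (simp add: w_def inner_diff_right inner_sum_right aE)
  then have w0: "w s0 \<noteq> 0" using i(2) by auto
  \<comment> \<open>By continuity \<open>w\<close> stays nonzero near \<open>s0\<close>, and the
    neighbourhood is shrunk accordingly.\<close>
  define U' where "U' = U \<inter> w -` (- {0})"
  have opU': "open U'"
    unfolding U'_def by (rule continuous_open_preimage[OF smooth_on_continuous[OF sw] U(1)]) auto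
  have U': "s0 \<in> U'" "U' \<subseteq> J" "U' \<subseteq> U" using w0 U by (auto simp: U'_def)
  have new: "smooth_on U' ((E(m := w)) k) \<and> smooth_on U' (\<lambda>s. (E(m := w)) k s \<bullet> c s) \<and>
      (\<forall>s\<in>U'. (E(m := w)) k s \<noteq> 0)" if "k < Suc m" for k
  proof (cases "k = m")
    case True
    then show ?thesis
      using smooth_on_subset[OF sw U'(3)] smooth_on_subset[OF swc U'(3)]
      by (auto simp: U'_def)
  next
    case False
    then have "k < m" using that by simp
    then show ?thesis
      using False E(3) smooth_on_subset[OF E(1) U'(3)] smooth_on_subset[OF E(2) U'(3)] U'(3)
      by auto
  qed
  have new_orth: "(E(m := w)) k s \<bullet> (E(m := w)) l s = 0"
    if "k < Suc m" "l < Suc m" "k \<noteq> l" "s \<in> U'" for k l s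
    using that orth[of k l s] worth[of k s] worth[of l s] U'(3)
    by (cases "k = m"; cases "l = m") (auto simp: inner_commute less_Suc_eq)
  show ?case
    by (intro exI[of _ U'] exI[of _ "E(m := w)"] conjI[OF opU'] conjI[OF U'(1)] conjI[OF U'(2)]
        conjI allI impI ballI new_orth) (use new in blast)+
qed

text \<open>Here \<open>c\<close> is the solution of a linear system with rows \<open>L i\<close>
  and smooth right-hand sides. In a smooth orthogonal frame of full size its coefficients are
  smooth, so \<open>c\<close> is too; full rank at \<open>s0\<close> alone suffices because the
  frame persists nearby.\<close>

lemma smooth_solution:
  fixes L :: "'i \<Rightarrow> 's::euclidean_space \<Rightarrow> 'v::euclidean_space"
  assumes "open J" "s0 \<in> J"
    and "\<forall>i\<in>K. smooth_on J (L i)" "\<forall>i\<in>K. smooth_on J (\<lambda>s. L i s \<bullet> c s)"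
    and "\<forall>a. (\<forall>i\<in>K. a \<bullet> L i s0 = 0) \<longrightarrow> a = 0"
  shows "\<exists>U. open U \<and> s0 \<in> U \<and> smooth_on U c"
proof -
  obtain U E where U: "open U" "s0 \<in> U"
    and E_all: "\<forall>i<DIM('v). smooth_on U (E i) \<and> smooth_on U (\<lambda>s. E i s \<bullet> c s) \<and> (\<forall>s\<in>U. E i s \<noteq> (0::'v))"
    and orth_all: "\<forall>i<DIM('v). \<forall>j<DIM('v). i \<noteq> j \<longrightarrow> (\<forall>s\<in>U. E i s \<bullet> E j s = 0)"
    using smooth_orthogonalisation[OF assms order_refl]
    by (elim exE conjE) (rule that; assumption)
  have E: "\<And>i. i < DIM('v) \<Longrightarrow> smooth_on U (E i)" "\<And>i. i < DIM('v) \<Longrightarrow> smooth_on U (\<lambda>s. E i s \<bullet> c s)"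
      "\<And>i s. i < DIM('v) \<Longrightarrow> s \<in> U \<Longrightarrow> E i s \<noteq> 0"
    using E_all by blast+
  have orth: "\<And>i j s. i < DIM('v) \<Longrightarrow> j < DIM('v) \<Longrightarrow> i \<noteq> j \<Longrightarrow> s \<in> U \<Longrightarrow> E i s \<bullet> E j s = 0"
    using orth_all by blast
  define q where "q j s = (E j s \<bullet> c s) * inverse (E j s \<bullet> E j s)" for j s
  have sq: "smooth_on U (q j)" if "j < DIM('v)" for j
    unfolding q_def[abs_def] using E(3)[OF that]
    by (intro smooth_on_mult[OF U(1) E(2)] smooth_on_inverse[OF U(1) smooth_on_inner[OF U(1) E(1) E(1)]])
      (use that in auto)
  have "smooth_on U c"
  proof (rule smooth_on_cong[OF U(1)])
    show "smooth_on U (\<lambda>s. \<Sum>j<DIM('v). q j s *\<^sub>R E j s)"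
      using U(1) E(1) sq by (intro smooth_on_sum smooth_on_scaleR) auto
    fix s assume s: "s \<in> U"
    have "E k s \<bullet> (\<Sum>j<DIM('v). q j s *\<^sub>R E j s) = E k s \<bullet> c s" if "k < DIM('v)" for k
    proof -
      have "E k s \<bullet> (\<Sum>j<DIM('v). q j s *\<^sub>R E j s) = (\<Sum>j<DIM('v). q j s * (E k s \<bullet> E j s))"
        by (simp add: inner_sum_right)
      also have "\<dots> = (\<Sum>j<DIM('v). if j = k then q k s * (E k s \<bullet> E k s) else 0)"
        by (rule sum.cong) (use orth[OF that _ _ s] in auto)
      also have "\<dots> = E k s \<bullet> c s" using that E(3)[OF that s] by (simp add: q_def)
      finally show ?thesis .
    qed
    then have "(\<Sum>j<DIM('v). q j s *\<^sub>R E j s) - c s = 0"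
      using E(3) orth s by (intro orthogonal_frame_vanish[of "\<lambda>i. E i s"]) (auto simp: inner_diff_right)
    then show "(\<Sum>j<DIM('v). q j s *\<^sub>R E j s) = c s" by simp
  qed
  then show ?thesis using U by blast
qed

section \<open>Charts of the product manifold\<close>

lemma D_slice:
  fixes H :: "'e::euclidean_space \<times> real \<Rightarrow> 'b::real_normed_vector"
  assumes "H differentiable (at (y, s))"
  shows "((\<lambda>y. H (y, s)) has_derivative (\<lambda>u. D H (y, s) (u, 0))) (at y)"
    and "((\<lambda>t. H (y, t)) has_vector_derivative D H (y, s) (0, 1)) (at s)"
proof -
  show "((\<lambda>y. H (y, s)) has_derivative (\<lambda>u. D H (y, s) (u, 0))) (at y)"
    by (rule has_derivative_compose[where f = "\<lambda>y. (y, s)", OF _ D_works[OF assms]])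
      (auto intro!: derivative_eq_intros)
  interpret linear "D H (y, s)" by (rule D_linear[OF assms])
  have "((\<lambda>t. H (y, t)) has_derivative (\<lambda>h. D H (y, s) (0, h))) (at s)"
    by (rule has_derivative_compose[where f = "\<lambda>t. (y, t)", OF _ D_works[OF assms]])
      (auto intro!: derivative_eq_intros)
  moreover have "(\<lambda>h. D H (y, s) (0, h)) = (\<lambda>h. h *\<^sub>R D H (y, s) (0, 1))"
    (is "?L = ?R")
  proof
    show "?L h = ?R h" for h using scale[of h "(0, 1)"] by simp
  qed
  ultimately show "((\<lambda>t. H (y, t)) has_vector_derivative D H (y, s) (0, 1)) (at s)"
    unfolding has_vector_derivative_def by (rule has_derivative_eq_rhs)
qed

text \<open>The derivative in direction \<open>(u, 0)\<close> is computed inside the slice at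
  \<open>s\<close>, so constancy on that slice is enough.\<close>

lemma D_leaf_const:
  fixes H :: "'e::euclidean_space \<times> real \<Rightarrow> 'b::real_normed_vector"
  assumes "H differentiable (at (y, s))" "open T" "y \<in> T" "\<And>z. z \<in> T \<Longrightarrow> H (z, s) = k"
  shows "D H (y, s) (u, 0) = 0"
  using D_eqI[OF D_slice(1)[OF assms(1)], of u] D_locally_const[OF assms(2,3), of "\<lambda>y. H (y, s)" k u] assms(4)
  by simp

lemma smooth_on_snd:
  fixes h :: "real \<Rightarrow> 'b::real_normed_vector" and S :: "('e::euclidean_space \<times> real) set"
  assumes "open S" "snd ` S \<subseteq> I" "smooth_on I h"
  shows "smooth_on S (\<lambda>x. h (snd x))"
  by (rule smooth_on_compose[OF assms smooth_on_bounded_linear[OF bounded_linear_snd assms(1)]])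

lemma D_snd:
  fixes h :: "real \<Rightarrow> 'b::real_normed_vector" and x :: "'e::euclidean_space \<times> real"
  assumes "h differentiable (at (snd x))"
  shows "D (\<lambda>x. h (snd x)) x (u, a) = D h (snd x) a"
  by (subst D_compose[OF bounded_linear_imp_differentiable[OF bounded_linear_snd] assms])
    (simp add: D_eqI[OF bounded_linear_imp_has_derivative[OF bounded_linear_snd]])

lemma vector_derivative_eq_D:
  "h differentiable (at s) \<Longrightarrow> vector_derivative h (at s) = D h s 1"
  by (simp add: frechet_derivative_eq_vector_derivative)

lemma deriv_eq_D:
  fixes h :: "real \<Rightarrow> real"
  assumes "h differentiable (at s)" shows "deriv h s = D h s 1"
  using D_works[OF assms] frechet_derivative_eq_vector_derivative[OF assms]
  by (intro DERIV_imp_deriv) (simp add: has_field_derivative_def mult_commute_abs)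

lemma chart_inv_left: "is_chart c \<Longrightarrow> p \<in> fst c \<Longrightarrow> chart_inv c (snd c p) = p"
  unfolding is_chart_def using homeomorphism_apply1 by blast

section \<open>The product atlas and its coordinate changes with the interval\<close>

locale product_manifold =
  fixes A :: "('m::topological_space, 'e::euclidean_space) chart set"
    and M0 :: "'m set" and I :: "real set"
  assumes atlas: "smooth_atlas M0 A" and open_I: "open I"
begin

abbreviation "\<A> \<equiv> prod_atlas A I"
abbreviation coords :: "('m \<times> real, 'e \<times> real) chart \<Rightarrow> ('e \<times> real) set"
  where "coords c \<equiv> snd c ` fst c"
abbreviation prod_chart :: "('m, 'e) chart \<Rightarrow> ('m \<times> real, 'e \<times> real) chart"
  where "prod_chart d \<equiv> (fst d \<times> I, map_prod (snd d) id)"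

lemma is_chart: "d \<in> A \<Longrightarrow> is_chart d"
  using atlas by (auto simp: smooth_atlas_def)

lemma prod_chart_in: "d \<in> A \<Longrightarrow> prod_chart d \<in> \<A>"
  unfolding prod_atlas_def by (cases d) auto

lemma prod_chartE:
  assumes "c \<in> \<A>" obtains d where "d \<in> A" "c = prod_chart d"
  using assms unfolding prod_atlas_def by force

lemma coords_prod_chart: "coords (prod_chart d) = (snd d ` fst d) \<times> I"
  by force

lemma open_coords: "c \<in> \<A> \<Longrightarrow> open (coords c)"
  using is_chart open_I by (elim prod_chartE) (simp only: coords_prod_chart, auto simp: is_chart_def open_Times)

lemma chart_inv_coords:
  assumes "c \<in> \<A>" "p \<in> fst c" shows "chart_inv c (snd c p) = p"
proof -
  obtain d where d: "d \<in> A" "c = prod_chart d" using assms(1) by (rule prod_chartE)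
  have "inj_on (snd d) (fst d)" using chart_inv_left[OF is_chart[OF d(1)]] by (rule inj_on_inverseI)
  then have "inj_on (snd c) (fst c)" using d(2) by (auto simp: inj_on_def)
  then show ?thesis using assms(2) by (simp add: chart_inv_def)
qed

lemma coords_chart_inv:
  assumes "c \<in> \<A>" "x \<in> coords c" shows "snd c (chart_inv c x) = x" "chart_inv c x \<in> fst c"
proof -
  obtain p where "p \<in> fst c" "x = snd c p" using assms(2) by blast
  then show "snd c (chart_inv c x) = x" "chart_inv c x \<in> fst c"
    using chart_inv_coords[OF assms(1)] by simp_all
qed

lemma chart_inv_prod_chart:
  assumes "d \<in> A" "x \<in> snd d ` fst d" "s \<in> I"
  shows "chart_inv (prod_chart d) (x, s) = (chart_inv d x, s)"
proof -
  obtain q where q: "q \<in> fst d" "x = snd d q" using assms(2) by blast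
  then have "chart_inv d x = q" using chart_inv_left[OF is_chart[OF assms(1)]] by simp
  then show ?thesis using chart_inv_coords[OF prod_chart_in[OF assms(1)], of "(q, s)"] q assms(3) by simp
qed

lemma continuous_chart_inv: "c \<in> \<A> \<Longrightarrow> continuous_on (coords c) (chart_inv c)"
proof (elim prod_chartE)
  fix d assume d: "d \<in> A" "c = prod_chart d"
  have "continuous_on (snd d ` fst d) (chart_inv d)"
    using is_chart[OF d(1)] by (simp add: is_chart_def homeomorphism_def)
  then have "continuous_on ((snd d ` fst d) \<times> I) (\<lambda>x. (chart_inv d (fst x), snd x))"
    by (intro continuous_on_Pair continuous_on_snd continuous_on_id
        continuous_on_compose2[OF _ continuous_on_fst[OF continuous_on_id]]) auto
  then show ?thesis
    unfolding d(2) coords_prod_chart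
    by (rule continuous_on_cong[THEN iffD1, rotated -1]) (auto simp: chart_inv_prod_chart[OF d(1)])
qed

lemma Union_\<A>: "(\<Union>c\<in>\<A>. fst c) = M0 \<times> I"
proof
  show "(\<Union>c\<in>\<A>. fst c) \<subseteq> M0 \<times> I"
    using atlas by (auto simp: smooth_atlas_def elim!: prod_chartE)
  show "M0 \<times> I \<subseteq> (\<Union>c\<in>\<A>. fst c)"
  proof clarify
    fix p s assume "p \<in> M0" "s \<in> I"
    then obtain d where "d \<in> A" "p \<in> fst d" using atlas by (auto simp: smooth_atlas_def)
    then show "(p, s) \<in> (\<Union>c\<in>\<A>. fst c)" using prod_chart_in[of d] \<open>s \<in> I\<close> by force
  qed
qed

lemma fst_subset: "c \<in> \<A> \<Longrightarrow> fst c \<subseteq> M0 \<times> I"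
  using Union_\<A> by blast

lemma chart_at:
  assumes "p \<in> M0" "s \<in> I" obtains d where "d \<in> A" "p \<in> fst d" "prod_chart d \<in> \<A>" "(p, s) \<in> fst (prod_chart d)"
  using assms atlas prod_chart_in by (auto simp: smooth_atlas_def)

lemma snd_coords: "c \<in> \<A> \<Longrightarrow> snd ` coords c \<subseteq> I"
  by (elim prod_chartE) auto

lemma snd_coord: "c \<in> \<A> \<Longrightarrow> snd (snd c p) = snd p"
  by (elim prod_chartE) (auto simp: map_prod_def split: prod.splits)

lemma snd_chart_inv: "c \<in> \<A> \<Longrightarrow> x \<in> coords c \<Longrightarrow> snd (chart_inv c x) = snd x"
  using snd_coord coords_chart_inv by metis

lemma smooth_map_iff:
  "smooth_map \<A> (M0 \<times> I) f \<longleftrightarrow> (\<forall>c\<in>\<A>. smooth_on (coords c) (f \<circ> chart_inv c))"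
  unfolding smooth_map_def using fst_subset by (intro ball_cong) (auto simp: Int_absorb2)

lemma smooth_map_subset:
  assumes "smooth_map \<A> (M0 \<times> I) f" shows "smooth_map \<A> W f"
  using assms unfolding smooth_map_iff unfolding smooth_map_def by (auto intro: smooth_on_subset)

lemma smooth_on_slice:
  assumes "smooth_map \<A> (M0 \<times> I) f" "p \<in> M0"
  shows "smooth_on I (\<lambda>s. f (p, s))"
proof -
  obtain d where d: "d \<in> A" "p \<in> fst d" using assms(2) atlas by (auto simp: smooth_atlas_def)
  have F: "smooth_on (coords (prod_chart d)) (f \<circ> chart_inv (prod_chart d))"
    using assms(1) prod_chart_in[OF d(1)] smooth_map_iff by blast
  have sub: "(\<lambda>s. (snd d p, s)) ` I \<subseteq> coords (prod_chart d)"
    unfolding coords_prod_chart using d by auto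
  have "smooth_on I (\<lambda>s. (f \<circ> chart_inv (prod_chart d)) (snd d p, s))"
    by (rule smooth_on_compose[OF open_I sub F smooth_on_Pair[OF open_I smooth_on_const smooth_on_id]])
  then show ?thesis
    by (rule smooth_on_cong[OF open_I, rotated])
      (use d chart_inv_coords[OF prod_chart_in[OF d(1)]] in force)
qed

text \<open>Product charts leave the interval coordinate unchanged, so the curve with fixed first
  component is a coordinate line in every one of them.\<close>

lemma push_ds_eq:
  assumes "c \<in> \<A>" "(p, s) \<in> fst c" "smooth_on (coords c) (f \<circ> chart_inv c)"
  shows "push_ds f p s = push c f (p, s) (0, 1)"
proof -
  obtain d where d: "d \<in> A" "c = prod_chart d" using assms(1) by (rule prod_chartE)
  have diff: "(f \<circ> chart_inv c) differentiable (at (snd c (p, s)))"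
    using assms smooth_on_differentiable by blast
  have "((\<lambda>t. (f \<circ> chart_inv c) (snd d p, t)) has_vector_derivative
      D (f \<circ> chart_inv c) (snd d p, s) (0, 1)) (at s)"
    by (rule D_slice(2)) (use diff d in \<open>simp add: o_def\<close>)
  then have "((\<lambda>t. f (p, t)) has_vector_derivative D (f \<circ> chart_inv c) (snd d p, s) (0, 1)) (at s)"
    by (rule has_vector_derivative_transform_within_open[of _ _ _ I])
      (use assms d open_I chart_inv_coords[OF assms(1)] in force)+
  then show ?thesis using d by (simp add: push_ds_def push_def vector_derivative_at)
qed

text \<open>A coordinate ball is convex, so the vanishing derivative makes \<open>h\<close> constant
  on it; thus \<open>h\<close> is locally constant on the leaf, and connectedness of
  \<open>M0\<close> makes it constant.\<close>

lemma leafwise_const: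
  fixes h :: "'m \<times> real \<Rightarrow> real"
  assumes "connected M0" "s \<in> I" "p \<in> M0" "q \<in> M0"
    and smooth: "\<And>c. c \<in> \<A> \<Longrightarrow> smooth_on (coords c) (h \<circ> chart_inv c)"
    and zero: "\<And>c x u. c \<in> \<A> \<Longrightarrow> x \<in> coords c \<Longrightarrow> snd x = s \<Longrightarrow> D (h \<circ> chart_inv c) x (u, 0) = 0"
  shows "h (p, s) = h (q, s)"
proof -
  have "\<forall>a\<in>M0. \<forall>\<^sub>F b in at a within M0. h (a, s) = h (b, s)"
  proof
    fix a assume "a \<in> M0"
    then obtain d where d: "d \<in> A" "a \<in> fst d" and c: "prod_chart d \<in> \<A>"
      using chart_at[OF _ assms(2)] by blast
    let ?H = "h \<circ> chart_inv (prod_chart d)"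
    have ch: "open (fst d)" "open (snd d ` fst d)" "continuous_on (fst d) (snd d)"
      using is_chart[OF d(1)] by (auto simp: is_chart_def homeomorphism_def)
    obtain r where r: "r > 0" "ball (snd d a) r \<subseteq> snd d ` fst d"
      using ch(2) d(2) by (meson image_eqI openE)
    have der: "((\<lambda>y. ?H (y, s)) has_derivative (\<lambda>_. 0)) (at y within ball (snd d a) r)"
      if "y \<in> ball (snd d a) r" for y
    proof -
      have y: "(y, s) \<in> coords (prod_chart d)"
        using that r assms(2) unfolding coords_prod_chart by auto
      show ?thesis
        using D_slice(1)[OF smooth_on_differentiable[OF smooth[OF c] y]] zero[OF c y]
        by (simp add: has_derivative_at_withinI)
    qed
    have eq: "h (a, s) = h (b, s)" if "b \<in> fst d" "snd d b \<in> ball (snd d a) r" for b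
      using has_derivative_zero_unique[OF convex_ball der, of "snd d a" "snd d b"] that r(1) d assms(2)
        chart_inv_coords[OF c, of "(a, s)"] chart_inv_coords[OF c, of "(b, s)"] by simp
    have "open (fst d \<inter> snd d -` ball (snd d a) r)"
      by (rule continuous_open_preimage[OF ch(3,1) open_ball])
    then have "\<forall>\<^sub>F b in at a within M0. b \<in> fst d \<inter> snd d -` ball (snd d a) r"
      using d(2) r(1) by (intro eventually_at_topological[THEN iffD2]) auto
    then show "\<forall>\<^sub>F b in at a within M0. h (a, s) = h (b, s)"
      by eventually_elim (use eq in auto)
  qed
  then show ?thesis using connected_local_const[of M0 p q "\<lambda>p. h (p, s)"] assms by simp
qed

end

section \<open>The Gauss map on the product manifold\<close>

context product_manifold
begin

section \<open>Nets and vector fields expressed in product charts\<close>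

lemma prod_chart_at:
  assumes "p \<in> M0" "s \<in> I" obtains c where "c \<in> \<A>" "(p, s) \<in> fst c"
  using assms Union_\<A> by (metis SigmaI UN_E)

text \<open>As \<open>E1\<close> is a line, orthogonality need only be tested against
  \<partial>_s.\<close>

lemma orthogonal_net_iff:
  fixes f :: "'m \<times> real \<Rightarrow> 'v::euclidean_space"
  assumes "smooth_map \<A> (M0 \<times> I) f"
  shows "orthogonal_net \<A> W f \<longleftrightarrow>
    (\<forall>c\<in>\<A>. \<forall>p\<in>fst c \<inter> W. \<forall>u. push c f p (u, 0) \<bullet> push c f p (0, 1) = 0)"
proof -
  have "push c f p (0, b) = b *\<^sub>R push c f p (0, 1)" if "c \<in> \<A>" "p \<in> fst c" for c p b
  proof -
    have "(f \<circ> chart_inv c) differentiable (at (snd c p))"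
      using assms that smooth_on_differentiable unfolding smooth_map_iff by blast
    then interpret linear "push c f p" unfolding push_def[abs_def] by (rule D_linear)
    show ?thesis using scale[of b "(0, 1)"] by simp
  qed
  then have lin: "push c f p (u, 0) \<bullet> push c f p (0, b) = b * (push c f p (u, 0) \<bullet> push c f p (0, 1))"
    if "c \<in> \<A>" "p \<in> fst c" for c p u b
    using that by (metis inner_scaleR_right)
  have "(\<forall>u\<in>E0. \<forall>v\<in>E1. induced_metric c f p u v = 0) \<longleftrightarrow>
      (\<forall>u. push c f p (u, 0) \<bullet> push c f p (0, 1) = 0)" (is "?L \<longleftrightarrow> ?R")
    if cp: "c \<in> \<A>" "p \<in> fst c" for c p
  proof
    assume L: ?L
    show ?R
    proof
      fix u :: 'e
      have "(u, 0) \<in> E0" "(0, 1) \<in> E1" by (simp_all add: E0_def E1_def)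
      with L show "push c f p (u, 0) \<bullet> push c f p (0, 1) = 0" unfolding induced_metric_def by blast
    qed
  next
    assume R: ?R
    show ?L
    proof (intro ballI)
      fix x y assume "x \<in> (E0 :: ('e \<times> real) set)" "y \<in> (E1 :: ('e \<times> real) set)"
      then obtain u b where "x = (u, 0)" "y = (0, b)" by (auto simp: E0_def E1_def)
      then show "induced_metric c f p x y = 0"
        using R lin[OF cp, of u b] by (simp add: induced_metric_def)
    qed
  qed
  then show ?thesis
    unfolding orthogonal_net_def by (intro ball_cong refl) simp
qed

lemma push_field:
  fixes f :: "'m \<times> real \<Rightarrow> 'v::euclidean_space"
  assumes "c \<in> \<A>" "p \<in> fst c" "smooth_map \<A> (M0 \<times> I) f" "smooth_on (coords c) (Y \<circ> chart_inv c)"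
  shows "push c (\<lambda>q. push c f q (Y q)) p u =
    D (\<lambda>y. D (f \<circ> chart_inv c) y ((Y \<circ> chart_inv c) y)) (snd c p) u"
proof -
  let ?F = "\<lambda>y. D (f \<circ> chart_inv c) y ((Y \<circ> chart_inv c) y)"
  have "smooth_on (coords c) ?F"
    using assms smooth_map_iff by (intro smooth_on_D_field[OF open_coords[OF assms(1)] _ assms(4)]) blast
  then have "D ?F (snd c p) u = D ((\<lambda>q. push c f q (Y q)) \<circ> chart_inv c) (snd c p) u"
    by (intro D_cong[OF open_coords[OF assms(1)]] smooth_on_differentiable)
      (use assms in \<open>auto simp: push_def coords_chart_inv\<close>)
  then show ?thesis by (simp add: push_def)
qed

end

section \<open>Local diffeomorphisms from the product to the sphere\<close>

locale spherical_map = product_manifold A M0 I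
  for A :: "('m::topological_space, 'e::euclidean_space) chart set" and M0 I +
  fixes N :: "'m \<times> real \<Rightarrow> 'v::euclidean_space"
  assumes dim: "DIM('v) = DIM('e \<times> real) + 1"
    and local_diffeo: "local_diffeo_to_sphere (prod_atlas A I) N"
begin

lemma smooth_N: "smooth_map \<A> (M0 \<times> I) N"
  using local_diffeo unfolding local_diffeo_to_sphere_def Union_\<A> by blast

lemma norm_N: "p \<in> M0 \<Longrightarrow> s \<in> I \<Longrightarrow> norm (N (p, s)) = 1"
  using local_diffeo unfolding local_diffeo_to_sphere_def Union_\<A> by force

text \<open>The ambient smooth map \<open>G\<close> recovers the coordinates from the values of
  \<open>N\<close> near the point, so by the chain rule its derivative is a left inverse of that of
  \<open>N\<close> in coordinates.\<close>

lemma spherical_chart: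
  assumes c: "c \<in> \<A>"
  shows "spherical_chart (coords c) (N \<circ> chart_inv c)"
proof
  show "open (coords c)" by (rule open_coords[OF c])
  show smooth: "smooth_on (coords c) (N \<circ> chart_inv c)" using smooth_N c smooth_map_iff by blast
  fix x assume x: "x \<in> coords c"
  let ?p = "chart_inv c x"
  have p: "?p \<in> fst c" "snd c ?p = x" using coords_chart_inv[OF c x] by auto
  show "norm ((N \<circ> chart_inv c) x) = 1"
    using p(1) fst_subset[OF c] norm_N[of "fst ?p" "snd ?p"] by auto
  obtain U V G where U: "open U" "?p \<in> U" "U \<subseteq> fst c" and V: "N ` U = V \<inter> sphere 0 1"
    and G: "smooth_on V G" "\<And>q. q \<in> U \<Longrightarrow> G (N q) = snd c q"
    using local_diffeo c p(1) unfolding local_diffeo_to_sphere_def by meson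
  let ?T = "coords c \<inter> chart_inv c -` U"
  have "open ?T"
    by (rule continuous_open_preimage[OF continuous_chart_inv[OF c] open_coords[OF c] U(1)])
  have dN: "(N \<circ> chart_inv c) differentiable (at x)" by (rule smooth_on_differentiable[OF smooth x])
  have dG: "G differentiable (at ((N \<circ> chart_inv c) x))"
    using smooth_on_differentiable[OF G(1)] V U(2) by auto
  have inv: "G ((N \<circ> chart_inv c) y) = y" if "y \<in> ?T" for y
    using that G(2) coords_chart_inv[OF c, of y] by auto
  have "D G ((N \<circ> chart_inv c) x) (D (N \<circ> chart_inv c) x v) = v" for v
  proof -
    have "D G ((N \<circ> chart_inv c) x) (D (N \<circ> chart_inv c) x v) = D (\<lambda>y. G ((N \<circ> chart_inv c) y)) x v"
      by (rule D_compose[OF dN dG, symmetric])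
    also have "\<dots> = D (\<lambda>y. y) x v"
      by (rule D_cong[OF \<open>open ?T\<close>, symmetric]) (use x U inv in auto)
    finally show ?thesis by simp
  qed
  then show "inj (D (N \<circ> chart_inv c) x)" by (metis injI)
qed (rule dim)

text \<open>The chart-independent version of \<open>spherical_chart.e\<close>; the two are
  identified in \<open>chart_expressions\<close>.\<close>

definition "unit_ds q = inverse (norm (push_ds N (fst q) (snd q))) *\<^sub>R push_ds N (fst q) (snd q)"

lemma chart_expressions:
  assumes "c \<in> \<A>" "x \<in> coords c"
  shows "push_ds N (fst (chart_inv c x)) (snd (chart_inv c x)) = spherical_chart.n_s (N \<circ> chart_inv c) x"
    and "norm (push_ds N (fst (chart_inv c x)) (snd (chart_inv c x))) = spherical_chart.rho (N \<circ> chart_inv c) x"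
    and "unit_ds (chart_inv c x) = spherical_chart.e (N \<circ> chart_inv c) x"
proof -
  interpret C: spherical_chart "coords c" "N \<circ> chart_inv c" by (rule spherical_chart[OF assms(1)])
  show 1: "push_ds N (fst (chart_inv c x)) (snd (chart_inv c x)) = C.n_s x"
    using push_ds_eq[OF assms(1), of "fst (chart_inv c x)" "snd (chart_inv c x)" N] coords_chart_inv[OF assms] C.smooth_n
    by (simp add: C.n_s_def push_def)
  show "norm (push_ds N (fst (chart_inv c x)) (snd (chart_inv c x))) = C.rho x"
    "unit_ds (chart_inv c x) = C.e x"
    unfolding unit_ds_def 1 by (simp_all add: C.rho_def C.e_def)
qed

lemma norm_push_ds_pos:
  assumes "p \<in> M0" "s \<in> I" shows "0 < norm (push_ds N p s)"
proof -
  obtain c where c: "c \<in> \<A>" "(p, s) \<in> fst c" using prod_chart_at[OF assms] .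
  interpret C: spherical_chart "coords c" "N \<circ> chart_inv c" by (rule spherical_chart[OF c(1)])
  have x: "snd c (p, s) \<in> coords c" using c(2) by blast
  show ?thesis
    using chart_expressions(2)[OF c(1) x] chart_inv_coords[OF c] C.rho_pos[OF x] by simp
qed

lemma smooth_unit_ds: "smooth_map \<A> (M0 \<times> I) unit_ds"
  unfolding smooth_map_iff
proof
  fix c assume c: "c \<in> \<A>"
  interpret C: spherical_chart "coords c" "N \<circ> chart_inv c" by (rule spherical_chart[OF c])
  show "smooth_on (coords c) (unit_ds \<circ> chart_inv c)"
    by (rule smooth_on_cong[OF C.open_S _ C.smooth_e]) (use chart_expressions(3)[OF c] in simp)
qed

lemma orthogonal_chart_iff:
  "orthogonal_net \<A> (M0 \<times> I) N \<longleftrightarrow> (\<forall>c\<in>\<A>. orthogonal_chart (coords c) (N \<circ> chart_inv c))"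
proof -
  have "(\<forall>p\<in>fst c \<inter> (M0 \<times> I). \<forall>u. push c N p (u, 0) \<bullet> push c N p (0, 1) = 0) \<longleftrightarrow>
      orthogonal_chart (coords c) (N \<circ> chart_inv c)" if c: "c \<in> \<A>" for c
  proof -
    have "fst c \<inter> (M0 \<times> I) = fst c" using fst_subset[OF c] by blast
    moreover have "orthogonal_chart (coords c) (N \<circ> chart_inv c) \<longleftrightarrow>
        (\<forall>x\<in>coords c. \<forall>u. D (N \<circ> chart_inv c) x (u, 0) \<bullet> D (N \<circ> chart_inv c) x (0, 1) = 0)"
      using spherical_chart[OF c] unfolding orthogonal_chart_def orthogonal_chart_axioms_def by blast
    ultimately show ?thesis unfolding push_def by blast
  qed
  then show ?thesis unfolding orthogonal_net_iff[OF smooth_N] by simp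
qed

text \<open>The metric \<open>g\<^sub>s\<close>: the one that the restriction of \<open>N\<close> to
  the leaf at \<open>s\<close> induces on \<open>M0\<close>.\<close>

definition "leaf_metric s d p u v =
  push (prod_chart d) N (p, s) (u, 0) \<bullet> push (prod_chart d) N (p, s) (v, 0)"

text \<open>The chain rule for the coordinate change, carried out on a single leaf; it yields the
  transformation rule for \<open>leaf_metric\<close>.\<close>

lemma push_change_chart:
  assumes d: "d \<in> A" "d' \<in> A" and p: "p \<in> fst d" "p \<in> fst d'" and s: "s \<in> I"
  shows "push (prod_chart d') N (p, s) (push d (snd d') p u, 0) = push (prod_chart d) N (p, s) (u, 0)"
proof -
  let ?c = "prod_chart d" and ?c' = "prod_chart d'" and ?\<tau> = "snd d' \<circ> chart_inv d"
  have c: "?c \<in> \<A>" "?c' \<in> \<A>" using d prod_chart_in by auto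
  have ch: "open (fst d')" "open (snd d ` fst d)" "continuous_on (snd d ` fst d) (chart_inv d)"
    using is_chart d by (auto simp: is_chart_def homeomorphism_def)
  let ?T = "(snd d ` fst d) \<inter> chart_inv d -` fst d'"
  have T: "open ?T" by (rule continuous_open_preimage[OF ch(3,2,1)])
  have left: "chart_inv d (snd d q) = q" if "q \<in> fst d" for q
    by (rule chart_inv_left[OF is_chart[OF d(1)] that])
  have pT: "snd d p \<in> ?T" using p left by auto
  have "?\<tau> differentiable (at (snd d p))"
    using atlas d p smooth_on_differentiable unfolding smooth_atlas_def by blast
  then have \<tau>: "(?\<tau> has_derivative D ?\<tau> (snd d p)) (at (snd d p))" by (rule D_works)
  have N': "(N \<circ> chart_inv ?c') differentiable (at (snd d' p, s))"
    using smooth_on_differentiable smooth_N c(2) p s unfolding smooth_map_iff by force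
  have eq: "(N \<circ> chart_inv ?c') (?\<tau> y, s) = (N \<circ> chart_inv ?c) (y, s)" if "y \<in> ?T" for y
  proof -
    have y: "y \<in> snd d ` fst d" "chart_inv d y \<in> fst d'" using that by auto
    have "chart_inv ?c' (?\<tau> y, s) = (chart_inv d' (?\<tau> y), s)"
      by (rule chart_inv_prod_chart[OF d(2)]) (use y s in auto)
    also have "\<dots> = (chart_inv d y, s)" using chart_inv_left[OF is_chart[OF d(2)] y(2)] by simp
    finally show ?thesis using chart_inv_prod_chart[OF d(1) y(1) s] by simp
  qed
  have \<tau>p: "?\<tau> (snd d p) = snd d' p" using left p by simp
  have "((\<lambda>y. (N \<circ> chart_inv ?c') (?\<tau> y, s)) has_derivative
      (\<lambda>u. D (N \<circ> chart_inv ?c') (snd d' p, s) (D ?\<tau> (snd d p) u, 0))) (at (snd d p))"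
  proof (rule has_derivative_compose[where f = "\<lambda>y. (?\<tau> y, s)" and g = "N \<circ> chart_inv ?c'"])
    show "((\<lambda>y. (?\<tau> y, s)) has_derivative (\<lambda>u. (D ?\<tau> (snd d p) u, 0))) (at (snd d p))"
      by (intro has_derivative_Pair \<tau> has_derivative_const)
    show "(N \<circ> chart_inv ?c' has_derivative D (N \<circ> chart_inv ?c') (snd d' p, s)) (at (?\<tau> (snd d p), s))"
      unfolding \<tau>p by (rule D_works[OF N'])
  qed
  then have hd: "((\<lambda>y. (N \<circ> chart_inv ?c) (y, s)) has_derivative
      (\<lambda>u. D (N \<circ> chart_inv ?c') (snd d' p, s) (D ?\<tau> (snd d p) u, 0))) (at (snd d p))"
    by (rule has_derivative_transform_within_open[OF _ T pT]) (rule eq)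
  have "(N \<circ> chart_inv ?c) differentiable (at (snd d p, s))"
    using smooth_on_differentiable smooth_N c(1) p s unfolding smooth_map_iff by force
  \<comment> \<open>The same map on the slice has been differentiated in the chart of
    \<open>d\<close> and through the chart of \<open>d'\<close>; derivatives are unique.\<close>
  from fun_cong[OF has_derivative_unique[OF D_slice(1)[OF this] hd], of u]
  show ?thesis unfolding push_def by simp
qed

text \<open>Expanding the induced metric in components along \<open>E0\<close> and \<partial>_s, the
  mixed terms vanish by orthogonality. Positive definiteness on the leaves comes from the
  injectivity of the derivative of \<open>N\<close>.\<close>

lemma induced_metric_splits:
  assumes "orthogonal_net \<A> (M0 \<times> I) N"
  shows "induced_metric_splits A M0 I N leaf_metric (\<lambda>q. norm (push_ds N (fst q) (snd q)))"
  unfolding induced_metric_splits_def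
proof (intro conjI)
  let ?F = "\<lambda>d. N \<circ> chart_inv (prod_chart d)"
  have chart: "orthogonal_chart (coords (prod_chart d)) (?F d)" if "d \<in> A" for d
    using assms orthogonal_chart_iff prod_chart_in[OF that] by blast
  show "smooth_metric_family A I leaf_metric"
    unfolding smooth_metric_family_def
  proof (intro ballI conjI allI impI)
    fix d assume d: "d \<in> A"
    interpret C: orthogonal_chart "coords (prod_chart d)" "?F d" by (rule chart[OF d])
    show "smooth_on (snd d ` fst d \<times> I) (\<lambda>(x, s). leaf_metric s d (chart_inv d x) u v)" for u v
      unfolding coords_prod_chart[symmetric]
    proof (rule smooth_on_cong[OF C.open_S])
      show "smooth_on (coords (prod_chart d)) (\<lambda>x. D (?F d) x (u, 0) \<bullet> D (?F d) x (v, 0))"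
        by (intro smooth_on_inner smooth_on_D C.smooth_n C.open_S)
      fix x assume "x \<in> coords (prod_chart d)"
      then obtain q s where "x = (snd d q, s)" "q \<in> fst d" "s \<in> I" by auto
      then show "D (?F d) x (u, 0) \<bullet> D (?F d) x (v, 0) =
          (case x of (x, s) \<Rightarrow> leaf_metric s d (chart_inv d x) u v)"
        using chart_inv_left[OF is_chart[OF d]] by (simp add: leaf_metric_def push_def)
    qed
    fix p s assume p: "p \<in> fst d" and s: "s \<in> I"
    have x: "(snd d p, s) \<in> coords (prod_chart d)" using p s by force
    interpret L: linear "D (?F d) (snd d p, s)" by (rule D_linear[OF C.n_diff[OF x]])
    have lin: "linear (\<lambda>u. D (?F d) (snd d p, s) (u, 0))"
      using L.add[of "(_, 0)" "(_, 0)"] L.scale[of _ "(_, 0)"] by (intro linearI) simp_all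
    have metric: "leaf_metric s d p u v = D (?F d) (snd d p, s) (u, 0) \<bullet> D (?F d) (snd d p, s) (v, 0)" for u v
      by (simp add: leaf_metric_def push_def)
    show "bilinear (leaf_metric s d p)"
      unfolding bilinear_def metric
      using linear_compose[OF lin bounded_linear.linear[OF bounded_linear_inner_left]]
        linear_compose[OF lin bounded_linear.linear[OF bounded_linear_inner_right]]
      by (simp add: o_def)
    show "leaf_metric s d p u v = leaf_metric s d p v u" for u v
      unfolding metric by (rule inner_commute)
    show "0 < leaf_metric s d p u u" if "u \<noteq> 0" for u
    proof -
      have "D (?F d) (snd d p, s) (u, 0) \<noteq> 0"
        using injD[OF C.inj_n[OF x], of "(u, 0)" 0] L.zero that by (auto simp: zero_prod_def)
      then show ?thesis unfolding metric by simp
    qed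
  next
    fix d d' p s u v assume "d \<in> A" "d' \<in> A" "p \<in> fst d \<inter> fst d'" "s \<in> I"
    then show "leaf_metric s d' p (push d (snd d') p u) (push d (snd d') p v) = leaf_metric s d p u v"
      unfolding leaf_metric_def using push_change_chart[of d d' p s] by simp
  qed
  show "smooth_map \<A> (M0 \<times> I) (\<lambda>q. norm (push_ds N (fst q) (snd q)))"
    unfolding smooth_map_iff
  proof
    fix c assume c: "c \<in> \<A>"
    interpret C: spherical_chart "coords c" "N \<circ> chart_inv c" by (rule spherical_chart[OF c])
    show "smooth_on (coords c) ((\<lambda>q. norm (push_ds N (fst q) (snd q))) \<circ> chart_inv c)"
      by (rule smooth_on_cong[OF C.open_S _ C.smooth_rho]) (use chart_expressions(2)[OF c] in simp)
  qed
  show "\<forall>p\<in>M0. \<forall>s\<in>I. 0 < norm (push_ds N (fst (p, s)) (snd (p, s)))"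
    using norm_push_ds_pos by simp
  have metric: "induced_metric (prod_chart d) N (p, s) (u, a) (v, b) =
      leaf_metric s d p u v + (norm (push_ds N p s))\<^sup>2 * (a * b)"
    if d: "d \<in> A" and p: "p \<in> fst d" and s: "s \<in> I" for d p s u v a b
  proof -
    interpret C: orthogonal_chart "coords (prod_chart d)" "?F d" by (rule chart[OF d])
    have x: "(snd d p, s) \<in> coords (prod_chart d)" using p s by force
    have "chart_inv (prod_chart d) (snd d p, s) = (p, s)"
      using chart_inv_coords[OF prod_chart_in[OF d], of "(p, s)"] p s by simp
    then have "norm (push_ds N p s) = norm (D (?F d) (snd d p, s) (0, 1))"
      using chart_expressions(2)[OF prod_chart_in[OF d] x] by (simp add: C.rho_def C.n_s_def)
    then show ?thesis
      using C.orth[OF x, of u] C.orth[OF x, of v]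
      unfolding induced_metric_def leaf_metric_def push_def
      by (simp add: D_split[OF C.n_diff[OF x], of u a] D_split[OF C.n_diff[OF x], of v b]
          inner_add_left inner_add_right power2_norm_eq_inner inner_commute[of "D _ _ (0, 1)" "D _ _ (_, 0)"])
  qed
  show "\<forall>(U, \<phi>)\<in>A. \<forall>p\<in>U. \<forall>s\<in>I. \<forall>u v a b.
      induced_metric (U \<times> I, map_prod \<phi> id) N (p, s) (u, a) (v, b) =
        leaf_metric s (U, \<phi>) p u v + (norm (push_ds N (fst (p, s)) (snd (p, s))))\<^sup>2 * (a * b)"
    using metric by fastforce
qed

lemma split_metric_at:
  assumes splits: "induced_metric_splits A M0 I N g \<rho>"
    and "d \<in> A" "p \<in> fst d" "s \<in> I"
  shows "push (prod_chart d) N (p, s) (u, 0) \<bullet> push (prod_chart d) N (p, s) (0, 1) = 0"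
    and "push (prod_chart d) N (p, s) (0, 1) \<bullet> push (prod_chart d) N (p, s) (0, 1) = (\<rho> (p, s))\<^sup>2"
proof -
  have "\<forall>(U, \<phi>)\<in>A. \<forall>p\<in>U. \<forall>s\<in>I. \<forall>u v a b.
        induced_metric (U \<times> I, map_prod \<phi> id) N (p, s) (u, a) (v, b) =
          g s (U, \<phi>) p u v + (\<rho> (p, s))\<^sup>2 * (a * b)"
    using splits by (simp add: induced_metric_splits_def)
  then have metric: "induced_metric (prod_chart d) N (p, s) (u, a) (v, b) = g s d p u v + (\<rho> (p, s))\<^sup>2 * (a * b)"
    for u v a b using assms by (cases d) auto
  have "smooth_metric_family A I g" using splits by (simp add: induced_metric_splits_def)
  note bspec[OF this[unfolded smooth_metric_family_def] assms(2), THEN conjunct2, THEN conjunct1]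
  then have "bilinear (g s d p)" by (rule conjunct1[OF bspec[OF bspec[OF _ assms(3)] assms(4)]])
  \<comment> \<open>The vector \<partial>_s has zero component in \<open>E0\<close>, so the leaf
    metric contributes nothing to products with it.\<close>
  then have "g s d p u 0 = 0" for u by (rule bilinear_rzero)
  then show "push (prod_chart d) N (p, s) (u, 0) \<bullet> push (prod_chart d) N (p, s) (0, 1) = 0"
    "push (prod_chart d) N (p, s) (0, 1) \<bullet> push (prod_chart d) N (p, s) (0, 1) = (\<rho> (p, s))\<^sup>2"
    using metric[of u 0 0 1] metric[of 0 1 0 1] by (simp_all add: induced_metric_def)
qed

lemma splits_imp_orthogonal:
  assumes "induced_metric_splits A M0 I N g \<rho>"
  shows "orthogonal_net \<A> (M0 \<times> I) N"
  unfolding orthogonal_net_iff[OF smooth_N]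
  using split_metric_at(1)[OF assms] by (auto elim!: prod_chartE)

text \<open>The splitting determines the square of \<rho>, and positivity selects the root. Hence
  the given \<rho> can be identified with \<open>C.rho\<close> in every chart.\<close>

lemma splits_imp_rho:
  assumes "induced_metric_splits A M0 I N g \<rho>" "p \<in> M0" "s \<in> I"
  shows "\<rho> (p, s) = norm (push_ds N p s)"
proof -
  obtain d where d: "d \<in> A" "p \<in> fst d" "prod_chart d \<in> \<A>" "(p, s) \<in> fst (prod_chart d)"
    using chart_at[OF assms(2,3)] by blast
  have "smooth_on (coords (prod_chart d)) (N \<circ> chart_inv (prod_chart d))"
    using smooth_N d(3) unfolding smooth_map_iff by blast
  then have "push_ds N p s = push (prod_chart d) N (p, s) (0, 1)" by (rule push_ds_eq[OF d(3,4)])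
  then have "(norm (push_ds N p s))\<^sup>2 = (\<rho> (p, s))\<^sup>2"
    using split_metric_at(2)[OF assms(1) d(1,2) assms(3)] by (simp add: power2_norm_eq_inner)
  moreover have "0 < \<rho> (p, s)" using assms by (simp add: induced_metric_splits_def)
  ultimately show ?thesis using power2_eq_iff_nonneg[of "norm (push_ds N p s)" "\<rho> (p, s)"] by simp
qed

section \<open>The direct statement\<close>

context
  fixes g \<rho> \<gamma> \<alpha> \<beta> f
  assumes splits: "induced_metric_splits A M0 I N g \<rho>"
    and smooth_\<gamma>: "smooth_on I \<gamma>" and smooth_\<alpha>: "smooth_on I \<alpha>" and smooth_\<beta>: "smooth_on I \<beta>"
    and compat: "compatibility_eq M0 I N \<rho> \<gamma> \<alpha> \<beta>"
    and param: "enneper_param M0 I N \<rho> \<gamma> \<alpha> \<beta> f"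
begin

lemma enneper_chart:
  assumes c: "c \<in> \<A>"
  shows "enneper_chart (coords c) (N \<circ> chart_inv c) (\<lambda>x. \<gamma> (snd x)) (f \<circ> chart_inv c)
    (\<lambda>x. \<alpha> (snd x)) (\<lambda>x. \<beta> (snd x))"
proof -
  interpret C: orthogonal_chart "coords c" "N \<circ> chart_inv c"
    using splits_imp_orthogonal[OF splits] orthogonal_chart_iff c by blast
  show ?thesis
  proof
    show "smooth_on (coords c) (\<lambda>x. \<gamma> (snd x))" "smooth_on (coords c) (\<lambda>x. \<alpha> (snd x))"
      "smooth_on (coords c) (\<lambda>x. \<beta> (snd x))"
      by (intro smooth_on_snd[OF open_coords[OF c] snd_coords[OF c]] smooth_\<gamma> smooth_\<alpha> smooth_\<beta>)+
    fix x assume x: "x \<in> coords c"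
    define q s where "q = fst (chart_inv c x)" and "s = snd x"
    have qs: "chart_inv c x = (q, s)" using snd_chart_inv[OF c x] by (simp add: q_def s_def prod_eq_iff)
    then have q: "q \<in> M0" and s: "s \<in> I" using coords_chart_inv(2)[OF c x] fst_subset[OF c] by auto
    have rho: "\<rho> (q, s) = C.rho x" and e: "unit_ds (q, s) = C.e x"
      using splits_imp_rho[OF splits q s] chart_expressions(2,3)[OF c x] qs by simp_all
    have d: "\<gamma> differentiable (at s)" "\<alpha> differentiable (at s)" "\<beta> differentiable (at s)"
      using smooth_on_differentiable smooth_\<gamma> smooth_\<alpha> smooth_\<beta> s by blast+
    have f: "f (q, s) = \<gamma> s + \<alpha> s *\<^sub>R N (q, s) + (\<beta> s * inverse (\<rho> (q, s))) *\<^sub>R push_ds N q s"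
      using param q s by (simp add: enneper_param_def)
    then have "f (q, s) = \<gamma> s + \<alpha> s *\<^sub>R N (q, s) + \<beta> s *\<^sub>R unit_ds (q, s)"
      using splits_imp_rho[OF splits q s] by (simp add: unit_ds_def)
    then show "(f \<circ> chart_inv c) x = \<gamma> (snd x) + \<alpha> (snd x) *\<^sub>R (N \<circ> chart_inv c) x + \<beta> (snd x) *\<^sub>R C.e x"
      using qs e s_def by simp
    show "D (\<lambda>x. \<gamma> (snd x)) x (u, 0) = 0" "D (\<lambda>x. \<alpha> (snd x)) x (u, 0) = 0"
      "D (\<lambda>x. \<beta> (snd x)) x (u, 0) = 0" for u
      using d linear_0[OF D_linear[OF d(1)]] linear_0[OF D_linear[OF d(2)]] linear_0[OF D_linear[OF d(3)]]
      by (simp_all add: D_snd s_def)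
    have "vector_derivative \<gamma> (at s) \<bullet> N (q, s) + deriv \<alpha> s = \<beta> s * \<rho> (q, s)"
      using compat q s by (simp add: compatibility_eq_def)
    then have "D \<gamma> s 1 \<bullet> N (q, s) + D \<alpha> s 1 = \<beta> s * C.rho x"
      by (simp add: vector_derivative_eq_D[OF d(1)] deriv_eq_D[OF d(2)] rho)
    then show "D (\<lambda>x. \<gamma> (snd x)) x (0, 1) \<bullet> (N \<circ> chart_inv c) x + D (\<lambda>x. \<alpha> (snd x)) x (0, 1) =
        \<beta> (snd x) * C.rho x"
      using d qs by (simp add: D_snd s_def)
  qed
qed

lemma smooth_f: "smooth_map \<A> (M0 \<times> I) f"
  unfolding smooth_map_iff using enneper_chart.smooth_F[OF enneper_chart] by blast

text \<open>The parametrization does not force \<open>f\<close> to be an immersion: if \<gamma>,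
  \<alpha> and \<beta> are zero, \<open>f\<close> is constant. The geometric conclusions are
  therefore drawn on \<open>regular_points\<close>.\<close>

lemma regular_inj:
  assumes "c \<in> \<A>" "p \<in> fst c" "p \<in> regular_points \<A> f"
  shows "inj (D (f \<circ> chart_inv c) (snd c p))"
  using assms by (auto simp: regular_points_def immersion_at_def push_def[abs_def])

lemma gauss_map_regular: "gauss_map \<A> (regular_points \<A> f) f N"
  unfolding gauss_map_def
proof (intro conjI ballI impI allI)
  show "smooth_map \<A> (regular_points \<A> f) N" by (rule smooth_map_subset[OF smooth_N])
  fix p assume "p \<in> regular_points \<A> f"
  then have "p \<in> M0 \<times> I" using Union_\<A> by (auto simp: regular_points_def)
  then show "norm (N p) = 1" using norm_N by auto
  fix c u assume c: "c \<in> \<A>" "p \<in> fst c"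
  interpret C: enneper_chart "coords c" "N \<circ> chart_inv c" "\<lambda>x. \<gamma> (snd x)" "f \<circ> chart_inv c"
    "\<lambda>x. \<alpha> (snd x)" "\<lambda>x. \<beta> (snd x)" by (rule enneper_chart[OF c(1)])
  show "N p \<bullet> push c f p u = 0"
    using C.n_DF[of "snd c p" u] c chart_inv_coords[OF c] by (simp add: push_def)
qed

lemma adapted_regular: "adapted_sff \<A> (regular_points \<A> f) f"
  unfolding adapted_sff_def
proof (intro ballI allI impI, elim conjE)
  fix c and X Y :: "'m \<times> real \<Rightarrow> 'e \<times> real" and p
  assume c: "c \<in> \<A>" and p: "p \<in> fst c \<inter> regular_points \<A> f"
    and X: "X ` fst c \<subseteq> E0" and Y: "smooth_map {c} (fst c) Y" "Y ` fst c \<subseteq> E1"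
  interpret C: enneper_chart "coords c" "N \<circ> chart_inv c" "\<lambda>x. \<gamma> (snd x)" "f \<circ> chart_inv c"
    "\<lambda>x. \<alpha> (snd x)" "\<lambda>x. \<beta> (snd x)" by (rule enneper_chart[OF c])
  have x: "snd c p \<in> coords c" using p by blast
  have inv: "chart_inv c (snd c p) = p" using chart_inv_coords[OF c] p by blast
  have smooth_Y: "smooth_on (coords c) (Y \<circ> chart_inv c)" using Y(1) by (simp add: smooth_map_def)
  have "X p \<in> E0" "Y p \<in> E1" using X Y(2) p by auto
  then obtain u where u: "X p = (u, 0)" and Y0: "fst ((Y \<circ> chart_inv c) (snd c p)) = 0"
    by (auto simp: E0_def E1_def inv)
  have "push c (\<lambda>q. push c f q (Y q)) p (X p) \<in> range (push c f p)"
    unfolding push_field[OF c _ smooth_f smooth_Y, of p, OF IntD1[OF p]] u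
    using C.adapted[OF x regular_inj[OF c IntD1[OF p] IntD2[OF p]] smooth_Y Y0, of u] by (simp add: push_def[abs_def])
  moreover have "subspace (range (push c f p))"
    unfolding push_def[abs_def] by (intro linear_subspace_image subspace_UNIV D_linear C.F_diff[OF x])
  ultimately show "second_fundamental_form c f X Y p = 0"
    unfolding second_fundamental_form_def by (simp add: normal_part_eq_0_iff)
qed

lemma enneper_type_regular: "enneper_type A M0 I (regular_points \<A> f) f"
  unfolding enneper_type_def
proof (intro conjI adapted_regular ballI)
  show "hypersurface \<A> (regular_points \<A> f) f"
    using smooth_map_subset[OF smooth_f] by (auto simp: hypersurface_def regular_points_def)
  show "orthogonal_net \<A> (regular_points \<A> f) f"
    unfolding orthogonal_net_iff[OF smooth_f]
  proof (intro ballI allI)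
    fix c p u assume c: "c \<in> \<A>" and p: "p \<in> fst c \<inter> regular_points \<A> f"
    interpret C: enneper_chart "coords c" "N \<circ> chart_inv c" "\<lambda>x. \<gamma> (snd x)" "f \<circ> chart_inv c"
      "\<lambda>x. \<alpha> (snd x)" "\<lambda>x. \<beta> (snd x)" by (rule enneper_chart[OF c])
    show "push c f p (u, 0) \<bullet> push c f p (0, 1) = 0"
      unfolding push_def using p by (intro C.DF_orth) blast
  qed
  fix s assume s: "s \<in> I"
  \<comment> \<open>If both coefficients vanish at \<open>s\<close>, the leaf contains no regular
    point and any positive radius serves; \<open>1\<close> is such a value.\<close>
  define r where "r = (if \<alpha> s = 0 \<and> \<beta> s = 0 then 1 else sqrt ((\<alpha> s)\<^sup>2 + (\<beta> s)\<^sup>2))"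
  have "0 < r" by (auto simp: r_def sum_power2_gt_zero_iff)
  moreover have "f ` (regular_points \<A> f \<inter> (M0 \<times> {s})) \<subseteq> sphere (\<gamma> s) r"
  proof clarify
    fix q assume q: "(q, s) \<in> regular_points \<A> f" "q \<in> M0"
    obtain c where c: "c \<in> \<A>" "(q, s) \<in> fst c" using prod_chart_at[OF q(2) s] .
    interpret C: enneper_chart "coords c" "N \<circ> chart_inv c" "\<lambda>x. \<gamma> (snd x)" "f \<circ> chart_inv c"
      "\<lambda>x. \<alpha> (snd x)" "\<lambda>x. \<beta> (snd x)" by (rule enneper_chart[OF c(1)])
    have x: "snd c (q, s) \<in> coords c" using c by blast
    have sx: "snd (snd c (q, s)) = s" using snd_coord[OF c(1)] by simp
    have "\<alpha> s \<noteq> 0 \<or> \<beta> s \<noteq> 0" using C.regular_nz[OF x regular_inj[OF c q(1)]] sx by simp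
    moreover have "(norm (f (q, s) - \<gamma> s))\<^sup>2 = (\<alpha> s)\<^sup>2 + (\<beta> s)\<^sup>2"
      using C.F_G[OF x] chart_inv_coords[OF c] sx by simp
    then have "norm (f (q, s) - \<gamma> s) = sqrt ((\<alpha> s)\<^sup>2 + (\<beta> s)\<^sup>2)" by (metis norm_ge_zero real_sqrt_unique)
    ultimately show "f (q, s) \<in> sphere (\<gamma> s) r" by (auto simp: r_def dist_norm norm_minus_commute)
  qed
  ultimately show "\<exists>c r. 0 < r \<and> f ` (regular_points \<A> f \<inter> (M0 \<times> {s})) \<subseteq> sphere c r" by blast
qed

end

section \<open>The converse\<close>

context
  fixes f
  assumes connected: "connected M0"
    and enneper: "enneper_type A M0 I (M0 \<times> I) f"
    and gauss: "gauss_map \<A> (M0 \<times> I) f N"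
begin

lemma smooth_surface: "smooth_map \<A> (M0 \<times> I) f"
  using enneper by (simp add: enneper_type_def hypersurface_def)

lemma gauss_chart:
  assumes c: "c \<in> \<A>"
  shows "gauss_chart (coords c) (N \<circ> chart_inv c) (f \<circ> chart_inv c)"
proof -
  interpret C: spherical_chart "coords c" "N \<circ> chart_inv c" by (rule spherical_chart[OF c])
  show ?thesis
  proof
    show smooth: "smooth_on (coords c) (f \<circ> chart_inv c)" using smooth_surface c smooth_map_iff by blast
    fix x assume x: "x \<in> coords c"
    define p where "p = chart_inv c x"
    have p: "p \<in> fst c" "snd c p = x" "p \<in> M0 \<times> I"
      using coords_chart_inv[OF c x] fst_subset[OF c] by (auto simp: p_def)
    show "inj (D (f \<circ> chart_inv c) x)"
      using enneper c p by (auto simp: enneper_type_def hypersurface_def immersion_at_def push_def[abs_def])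
    show n_DF: "(N \<circ> chart_inv c) x \<bullet> D (f \<circ> chart_inv c) x v = 0" for v
    proof -
      have "N p \<bullet> push c f p v = 0" using gauss c p unfolding gauss_map_def by blast
      then show ?thesis unfolding push_def p(2) by (simp add: p_def)
    qed
    show "D (f \<circ> chart_inv c) x (u, 0) \<bullet> D (f \<circ> chart_inv c) x (0, 1) = 0" for u
      using enneper c p by (auto simp: enneper_type_def orthogonal_net_iff[OF smooth_surface] push_def)
    fix u
    \<comment> \<open>The constant coordinate fields are admissible test fields for adaptedness and
      already give the property required of the chart.\<close>
    have "second_fundamental_form c f (\<lambda>_. (u, 0)) (\<lambda>_. (0, 1)) p = 0"
    proof -
      have "smooth_map {c} (fst c) (\<lambda>_. (u, 0))" "smooth_map {c} (fst c) (\<lambda>_. (0, 1))"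
        by (simp_all add: smooth_map_def o_def smooth_on_const)
      moreover have "(\<lambda>_. (u, 0)) ` fst c \<subseteq> E0" "(\<lambda>_. (0, 1)) ` fst c \<subseteq> E1"
        by (auto simp: E0_def E1_def)
      ultimately show ?thesis using enneper c p unfolding enneper_type_def adapted_sff_def by blast
    qed
    moreover have "subspace (range (push c f p))"
      unfolding push_def[abs_def] p(2)
      by (intro linear_subspace_image subspace_UNIV D_linear smooth_on_differentiable[OF smooth x])
    ultimately have "push c (\<lambda>q. push c f q (0, 1)) p (u, 0) \<in> range (push c f p)"
      by (simp add: second_fundamental_form_def normal_part_eq_0_iff)
    then have "D (\<lambda>y. D (f \<circ> chart_inv c) y (0, 1)) x (u, 0) \<in> range (D (f \<circ> chart_inv c) x)"
      using push_field[OF c p(1) smooth_surface, of "\<lambda>_. (0, 1)"] p(2)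
      by (simp add: o_def smooth_on_const push_def[abs_def])
    then show "(N \<circ> chart_inv c) x \<bullet> D (\<lambda>y. D (f \<circ> chart_inv c) y (0, 1)) x (u, 0) = 0"
      using n_DF by auto
  qed
qed

lemma orthogonal_gauss: "orthogonal_net \<A> (M0 \<times> I) N"
  unfolding orthogonal_chart_iff
proof
  fix c assume "c \<in> \<A>"
  then interpret C: gauss_chart "coords c" "N \<circ> chart_inv c" "f \<circ> chart_inv c" by (rule gauss_chart)
  show "orthogonal_chart (coords c) (N \<circ> chart_inv c)" by (rule C.orthogonal_chart_axioms)
qed

section \<open>Consequences of one leaf lying in a sphere about \<open>k\<close>\<close>

context
  fixes s k r
  assumes s: "s \<in> I" and leaf: "f ` (M0 \<times> {s}) \<subseteq> sphere k r"
begin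

text \<open>The squared distance to \<open>k\<close> is constant on the leaf; its derivative along
  \<open>E0\<close> is twice this inner product.\<close>

lemma leaf_centre_orthogonal:
  assumes c: "c \<in> \<A>" and x: "x \<in> coords c" "snd x = s"
  shows "((f \<circ> chart_inv c) x - k) \<bullet> D (f \<circ> chart_inv c) x (u, 0) = 0"
proof -
  interpret C: gauss_chart "coords c" "N \<circ> chart_inv c" "f \<circ> chart_inv c" by (rule gauss_chart[OF c])
  let ?w = "\<lambda>y. (f \<circ> chart_inv c) y - k"
  obtain d where d: "d \<in> A" "c = prod_chart d" using prod_chartE[OF c] .
  have xy: "x = (fst x, s)" using x(2) by (simp add: prod_eq_iff)
  have "?w y \<bullet> ?w y = r\<^sup>2" if "y \<in> coords c" "snd y = s" for y
  proof -
    have "chart_inv c y \<in> M0 \<times> {s}"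
      using coords_chart_inv(2)[OF c that(1)] fst_subset[OF c] snd_chart_inv[OF c that(1)] that(2)
      by (cases "chart_inv c y") auto
    then have "norm (?w y) = r" using leaf by (force simp: dist_norm norm_minus_commute)
    then show ?thesis by (metis power2_norm_eq_inner)
  qed
  then have "?w (z, s) \<bullet> ?w (z, s) = r\<^sup>2" if "z \<in> snd d ` fst d" for z
    using that s unfolding d(2) coords_prod_chart by auto
  moreover have "(\<lambda>y. ?w y \<bullet> ?w y) differentiable (at (fst x, s))"
    using differentiable_bilinear[OF bounded_bilinear_inner C.F_shift_diff[OF x(1)] C.F_shift_diff[OF x(1)]]
    unfolding xy[symmetric] .
  moreover have "open (snd d ` fst d)" using is_chart[OF d(1)] by (simp add: is_chart_def)
  moreover have "fst x \<in> snd d ` fst d" using x(1) unfolding d(2) coords_prod_chart by auto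
  ultimately have "D (\<lambda>y. ?w y \<bullet> ?w y) (fst x, s) (u, 0) = 0"
    by (intro D_leaf_const) auto
  then show ?thesis
    using D_inner[OF C.F_shift_diff[OF x(1)] C.F_shift_diff[OF x(1)], of k k "(u, 0)"] xy
      C.D_shift[OF x(1)] by (simp add: inner_commute)
qed

lemma leaf_coefficients:
  assumes "p \<in> M0" "q \<in> M0"
  shows "(f (p, s) - k) \<bullet> N (p, s) = (f (q, s) - k) \<bullet> N (q, s)"
    and "(f (p, s) - k) \<bullet> unit_ds (p, s) = (f (q, s) - k) \<bullet> unit_ds (q, s)"
proof -
  \<comment> \<open>The two coefficients differ only in the field paired with \<open>f - k\<close>;
    both reduce to a vanishing derivative along the leaf in every chart.\<close>
  have const: "(f (p, s) - k) \<bullet> h (p, s) = (f (q, s) - k) \<bullet> h (q, s)"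
    if h: "smooth_map \<A> (M0 \<times> I) h"
      and zero: "\<And>c x u. c \<in> \<A> \<Longrightarrow> x \<in> coords c \<Longrightarrow> snd x = s \<Longrightarrow>
        D (\<lambda>y. ((f \<circ> chart_inv c) y - k) \<bullet> (h \<circ> chart_inv c) y) x (u, 0) = 0" for h
  proof (rule leafwise_const[OF connected s assms, of "\<lambda>q. (f q - k) \<bullet> h q"])
    fix c assume c: "c \<in> \<A>"
    have "smooth_on (coords c) (f \<circ> chart_inv c)" "smooth_on (coords c) (h \<circ> chart_inv c)"
      using h smooth_surface c unfolding smooth_map_iff by blast+
    note sm = this[unfolded o_def]
    have "smooth_on (coords c) (\<lambda>y. (f (chart_inv c y) - k) \<bullet> h (chart_inv c y))"
      by (rule smooth_on_inner[OF open_coords[OF c] smooth_on_diff[OF open_coords[OF c] sm(1) smooth_on_const] sm(2)])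
    then show "smooth_on (coords c) ((\<lambda>q. (f q - k) \<bullet> h q) \<circ> chart_inv c)" by (simp add: o_def)
    show "D ((\<lambda>q. (f q - k) \<bullet> h q) \<circ> chart_inv c) x (u, 0) = 0" if "x \<in> coords c" "snd x = s" for x u
      using zero[OF c that, of u] by (simp add: o_def)
  qed
  show "(f (p, s) - k) \<bullet> N (p, s) = (f (q, s) - k) \<bullet> N (q, s)"
  proof (rule const[OF smooth_N])
    fix c x u assume c: "c \<in> \<A>" and x: "x \<in> coords c" "snd x = s"
    interpret C: gauss_chart "coords c" "N \<circ> chart_inv c" "f \<circ> chart_inv c" by (rule gauss_chart[OF c])
    show "D (\<lambda>y. ((f \<circ> chart_inv c) y - k) \<bullet> (N \<circ> chart_inv c) y) x (u, 0) = 0"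
      by (rule C.D_normal_coefficient[OF x(1) leaf_centre_orthogonal[OF c x]])
  qed
  show "(f (p, s) - k) \<bullet> unit_ds (p, s) = (f (q, s) - k) \<bullet> unit_ds (q, s)"
  proof (rule const[OF smooth_unit_ds])
    fix c x u assume c: "c \<in> \<A>" and x: "x \<in> coords c" "snd x = s"
    interpret C: gauss_chart "coords c" "N \<circ> chart_inv c" "f \<circ> chart_inv c" by (rule gauss_chart[OF c])
    have "D (\<lambda>y. ((f \<circ> chart_inv c) y - k) \<bullet> (unit_ds \<circ> chart_inv c) y) x (u, 0) =
        D (\<lambda>y. ((f \<circ> chart_inv c) y - k) \<bullet> C.e y) x (u, 0)"
      by (rule D_cong[OF C.open_S x(1), symmetric])
        (use chart_expressions(3)[OF c] differentiable_bilinear[OF bounded_bilinear_inner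
            C.F_shift_diff[OF x(1)] C.e_diff[OF x(1)]] in simp_all)
    then show "D (\<lambda>y. ((f \<circ> chart_inv c) y - k) \<bullet> (unit_ds \<circ> chart_inv c) y) x (u, 0) = 0"
      using C.D_tangent_coefficient[OF x(1) leaf_centre_orthogonal[OF c x]] by simp
  qed
qed

lemma leaf_decomposition:
  assumes "p \<in> M0"
  shows "f (p, s) = k + ((f (p, s) - k) \<bullet> N (p, s)) *\<^sub>R N (p, s) +
    ((f (p, s) - k) \<bullet> unit_ds (p, s)) *\<^sub>R unit_ds (p, s)"
proof -
  obtain c where c: "c \<in> \<A>" "(p, s) \<in> fst c" using prod_chart_at[OF assms s] .
  interpret C: gauss_chart "coords c" "N \<circ> chart_inv c" "f \<circ> chart_inv c" by (rule gauss_chart[OF c(1)])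
  have x: "snd c (p, s) \<in> coords c" "snd (snd c (p, s)) = s" using c snd_coord[OF c(1)] by auto
  have "unit_ds (p, s) = C.e (snd c (p, s))"
    using chart_expressions(3)[OF c(1) x(1)] chart_inv_coords[OF c] by simp
  then show ?thesis
    using C.centre_decomposition[OF x(1) leaf_centre_orthogonal[OF c(1) x]] chart_inv_coords[OF c]
    by (simp add: algebra_simps)
qed

end

lemma smooth_centres:
  assumes centre: "\<And>s. s \<in> I \<Longrightarrow> \<exists>r. f ` (M0 \<times> {s}) \<subseteq> sphere (\<gamma> s) r"
    and p0: "p0 \<in> M0" and s0: "s0 \<in> I" "s0 \<notin> planar_parameters M0 I f"
  shows "\<exists>U. open U \<and> s0 \<in> U \<and> smooth_on U \<gamma>"
proof (rule smooth_solution[OF open_I s0(1), of M0 "\<lambda>p s. f (p, s) - f (p0, s)"])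
  have sl: "smooth_on I (\<lambda>s. f (p, s))" if "p \<in> M0" for p
    by (rule smooth_on_slice[OF smooth_surface that])
  show "\<forall>p\<in>M0. smooth_on I (\<lambda>s. f (p, s) - f (p0, s))"
    using sl p0 open_I by (auto intro: smooth_on_diff)
  show "\<forall>p\<in>M0. smooth_on I (\<lambda>s. (f (p, s) - f (p0, s)) \<bullet> \<gamma> s)"
  proof
    fix p assume p: "p \<in> M0"
    have "smooth_on I (\<lambda>s. (1 / 2) * (f (p, s) \<bullet> f (p, s) - f (p0, s) \<bullet> f (p0, s)))"
      by (intro smooth_on_mult smooth_on_const smooth_on_diff smooth_on_inner sl p p0 open_I)
    then show "smooth_on I (\<lambda>s. (f (p, s) - f (p0, s)) \<bullet> \<gamma> s)"
    proof (rule smooth_on_cong[OF open_I, rotated])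
      fix s assume "s \<in> I"
      then obtain r where "f ` (M0 \<times> {s}) \<subseteq> sphere (\<gamma> s) r" using centre by blast
      then have "f (p, s) \<in> sphere (\<gamma> s) r" "f (p0, s) \<in> sphere (\<gamma> s) r" using p p0 by blast+
      then have "dist (\<gamma> s) (f (p, s)) = r" "dist (\<gamma> s) (f (p0, s)) = r" by simp_all
      \<comment> \<open>Equating the two squared distances eliminates the radius and the quadratic
        term in \<open>\<gamma> s\<close>, leaving a linear equation.\<close>
      then have "(norm (\<gamma> s - f (p, s)))\<^sup>2 = (norm (\<gamma> s - f (p0, s)))\<^sup>2" by (simp add: dist_norm)
      then show "(1 / 2) * (f (p, s) \<bullet> f (p, s) - f (p0, s) \<bullet> f (p0, s)) = (f (p, s) - f (p0, s)) \<bullet> \<gamma> s"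
        unfolding power2_norm_eq_inner by (simp add: inner_diff_left inner_diff_right inner_commute)
    qed
  qed
  show "\<forall>a. (\<forall>p\<in>M0. a \<bullet> (f (p, s0) - f (p0, s0)) = 0) \<longrightarrow> a = 0"
  proof (intro allI impI, rule ccontr)
    \<comment> \<open>A common normal of all the differences would place the leaf at
      \<open>s0\<close> in a hyperplane, contrary to the choice of \<open>s0\<close>.\<close>
    fix a assume a: "\<forall>p\<in>M0. a \<bullet> (f (p, s0) - f (p0, s0)) = 0" "a \<noteq> 0"
    then have "f ` (M0 \<times> {s0}) \<subseteq> {x. a \<bullet> x = a \<bullet> f (p0, s0)}" by (auto simp: inner_diff_right)
    then show False using s0 a(2) unfolding planar_parameters_def by blast
  qed
qed

lemma converse:
  assumes centres: "smooth_centres_near_planar_leaves M0 I f"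
  shows "\<exists>g \<rho> \<gamma> \<alpha> \<beta>. induced_metric_splits A M0 I N g \<rho> \<and>
    smooth_on I \<gamma> \<and> smooth_on I \<alpha> \<and> smooth_on I \<beta> \<and>
    compatibility_eq M0 I N \<rho> \<gamma> \<alpha> \<beta> \<and> enneper_param M0 I N \<rho> \<gamma> \<alpha> \<beta> f"
\<comment> \<open>Without a point of \<open>M0\<close> there is no base point at which to read off
  \<alpha> and \<beta>, but both equations then hold vacuously.\<close>
proof (cases "M0 = {}")
  case True
  then have "compatibility_eq M0 I N \<rho> \<gamma> \<alpha> \<beta>" "enneper_param M0 I N \<rho> \<gamma> \<alpha> \<beta> f" for \<rho> \<gamma> \<alpha> \<beta>
    by (simp_all add: compatibility_eq_def enneper_param_def)
  then show ?thesis
    using induced_metric_splits[OF orthogonal_gauss] smooth_on_const[of I "0::'v"] smooth_on_const[of I "0::real"]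
    by blast
next
  case False
  then obtain p0 where p0: "p0 \<in> M0" by blast
  obtain J z where J: "open J" "planar_parameters M0 I f \<subseteq> J" "J \<subseteq> I" "smooth_on J z"
    and z: "\<And>s. s \<in> J \<Longrightarrow> \<exists>r>0. f ` (M0 \<times> {s}) \<subseteq> sphere (z s) r"
    using centres unfolding smooth_centres_near_planar_leaves_def by blast
  \<comment> \<open>Near planar leaves the centres come from the given smooth family; elsewhere they
    are chosen arbitrarily, and their smoothness follows from \<open>smooth_centres\<close>.\<close>
  define \<gamma> where "\<gamma> s = (if s \<in> J then z s else SOME k. \<exists>r. f ` (M0 \<times> {s}) \<subseteq> sphere k r)" for s
  have \<gamma>: "\<exists>r. f ` (M0 \<times> {s}) \<subseteq> sphere (\<gamma> s) r" if "s \<in> I" for s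
  proof (cases "s \<in> J")
    case True
    then show ?thesis using z[OF True] by (auto simp: \<gamma>_def)
  next
    case False
    have "(M0 \<times> I) \<inter> (M0 \<times> {s}) = M0 \<times> {s}" using that by auto
    then have "\<exists>k r. f ` (M0 \<times> {s}) \<subseteq> sphere k r"
      using enneper that unfolding enneper_type_def by metis
    then show ?thesis using someI_ex[of "\<lambda>k. \<exists>r. f ` (M0 \<times> {s}) \<subseteq> sphere k r"] False by (simp add: \<gamma>_def)
  qed
  have smooth_\<gamma>: "smooth_on I \<gamma>"
  proof (rule smooth_on_local)
    fix s assume s: "s \<in> I"
    show "\<exists>U. open U \<and> s \<in> U \<and> smooth_on U \<gamma>"
    proof (cases "s \<in> J")
      case True
      have "smooth_on J \<gamma>" by (rule smooth_on_cong[OF J(1) _ J(4)]) (simp add: \<gamma>_def)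
      then show ?thesis using J(1) True by blast
    next
      case False
      then show ?thesis using smooth_centres[OF \<gamma> p0 s] J(2) by blast
    qed
  qed
  \<comment> \<open>The coefficients are constant along each leaf, so evaluating them at
    \<open>p0\<close> gives functions of \<open>s\<close> valid on the whole leaf.\<close>
  define \<alpha> where "\<alpha> s = (f (p0, s) - \<gamma> s) \<bullet> N (p0, s)" for s
  define \<beta> where "\<beta> s = (f (p0, s) - \<gamma> s) \<bullet> unit_ds (p0, s)" for s
  define \<rho> where "\<rho> q = norm (push_ds N (fst q) (snd q))" for q
  have smooth_\<alpha>: "smooth_on I \<alpha>" and smooth_\<beta>: "smooth_on I \<beta>"
    unfolding \<alpha>_def[abs_def] \<beta>_def[abs_def]
    by (intro smooth_on_inner smooth_on_diff open_I smooth_\<gamma> p0 smooth_on_slice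
        smooth_surface smooth_N smooth_unit_ds)+
  have f_eq: "f (p, s) = \<gamma> s + \<alpha> s *\<^sub>R N (p, s) + \<beta> s *\<^sub>R unit_ds (p, s)" if ps: "p \<in> M0" "s \<in> I" for p s
  proof -
    obtain r where r: "f ` (M0 \<times> {s}) \<subseteq> sphere (\<gamma> s) r" using \<gamma>[OF ps(2)] by blast
    show ?thesis
      using leaf_decomposition[OF ps(2) r ps(1)] leaf_coefficients[OF ps(2) r ps(1) p0]
      by (simp add: \<alpha>_def \<beta>_def)
  qed
  have "enneper_param M0 I N \<rho> \<gamma> \<alpha> \<beta> f"
    unfolding enneper_param_def by (simp add: f_eq unit_ds_def \<rho>_def)
  moreover have "compatibility_eq M0 I N \<rho> \<gamma> \<alpha> \<beta>"
    unfolding compatibility_eq_def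
  proof (intro ballI)
    fix p s assume p: "p \<in> M0" and s: "s \<in> I"
    obtain c where c: "c \<in> \<A>" "(p, s) \<in> fst c" using prod_chart_at[OF p s] .
    interpret C: gauss_chart "coords c" "N \<circ> chart_inv c" "f \<circ> chart_inv c" by (rule gauss_chart[OF c(1)])
    define x where "x = snd c (p, s)"
    have x: "x \<in> coords c" "snd x = s" using c snd_coord[OF c(1)] by (auto simp: x_def)
    have d: "\<gamma> differentiable (at (snd x))" "\<alpha> differentiable (at (snd x))"
      using smooth_on_differentiable smooth_\<gamma> smooth_\<alpha> s x(2) by blast+
    note sm = smooth_on_snd[OF open_coords[OF c(1)] snd_coords[OF c(1)]]
    \<comment> \<open>Since \<open>N\<close> is normal to \<open>f\<close>, the left-hand side is
      zero, and the identity becomes the compatibility equation.\<close>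
    have "(N \<circ> chart_inv c) x \<bullet> D (f \<circ> chart_inv c) x (0, 1) =
        D (\<lambda>x. \<gamma> (snd x)) x (0, 1) \<bullet> (N \<circ> chart_inv c) x + D (\<lambda>x. \<alpha> (snd x)) x (0, 1) - \<beta> (snd x) * C.rho x"
    proof (rule C.n_D_combination[OF x(1) sm[OF smooth_\<gamma>] sm[OF smooth_\<alpha>] sm[OF smooth_\<beta>]])
      fix y assume y: "y \<in> coords c"
      have "chart_inv c y = (fst (chart_inv c y), snd y)"
        using snd_chart_inv[OF c(1) y] by (simp add: prod_eq_iff)
      moreover have "chart_inv c y \<in> M0 \<times> I" using coords_chart_inv(2)[OF c(1) y] fst_subset[OF c(1)] by blast
      ultimately show "(f \<circ> chart_inv c) y = \<gamma> (snd y) + \<alpha> (snd y) *\<^sub>R (N \<circ> chart_inv c) y + \<beta> (snd y) *\<^sub>R C.e y"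
        using f_eq[of "fst (chart_inv c y)" "snd y"] chart_expressions(3)[OF c(1) y] by auto
    qed
    moreover have "C.rho x = \<rho> (p, s)"
      using chart_expressions(2)[OF c(1) x(1)] chart_inv_coords[OF c] by (simp add: \<rho>_def x_def)
    moreover have "chart_inv c x = (p, s)" using chart_inv_coords[OF c] by (simp add: x_def)
    ultimately show "vector_derivative \<gamma> (at s) \<bullet> N (p, s) + deriv \<alpha> s = \<beta> s * \<rho> (p, s)"
      using C.n_DF[OF x(1), of "(0, 1)"] d x(2)
      by (simp add: D_snd vector_derivative_eq_D deriv_eq_D)
  qed
  moreover have "induced_metric_splits A M0 I N leaf_metric \<rho>"
    unfolding \<rho>_def[abs_def] by (rule induced_metric_splits[OF orthogonal_gauss])
  ultimately show ?thesis using smooth_\<gamma> smooth_\<alpha> smooth_\<beta> by blast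
qed

end

end

theorem theorem26:
  fixes A :: "('m::{t2_space, second_countable_topology}, 'e::euclidean_space) chart set"
    and M0 :: "'m set" and I :: "real set"
    and N :: "'m \<times> real \<Rightarrow> 'v::euclidean_space"
    and n :: nat
  assumes "DIM('e) + 1 = n" and "DIM('v) = n + 1"
    and "smooth_atlas M0 A"
    and "open I" and "is_interval I" and "I \<noteq> {}"
    and "local_diffeo_to_sphere (prod_atlas A I) N"
  shows
    "(orthogonal_net (prod_atlas A I) (M0 \<times> I) N \<longleftrightarrow> (\<exists>g \<rho>. induced_metric_splits A M0 I N g \<rho>)) \<and>
     (\<forall>g \<rho> \<gamma> \<alpha> \<beta> f.
        orthogonal_net (prod_atlas A I) (M0 \<times> I) N \<and> induced_metric_splits A M0 I N g \<rho> \<and>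
        smooth_on I \<gamma> \<and> smooth_on I \<alpha> \<and> smooth_on I \<beta> \<and>
        compatibility_eq M0 I N \<rho> \<gamma> \<alpha> \<beta> \<and> enneper_param M0 I N \<rho> \<gamma> \<alpha> \<beta> f \<longrightarrow>
          enneper_type A M0 I (regular_points (prod_atlas A I) f) f \<and>
          gauss_map (prod_atlas A I) (regular_points (prod_atlas A I) f) f N) \<and>
     (\<forall>f.
        connected M0 \<and> enneper_type A M0 I (M0 \<times> I) f \<and>
        gauss_map (prod_atlas A I) (M0 \<times> I) f N \<and>
        smooth_centres_near_planar_leaves M0 I f \<longrightarrow>
          (\<exists>g \<rho> \<gamma> \<alpha> \<beta>.
             induced_metric_splits A M0 I N g \<rho> \<and>
             smooth_on I \<gamma> \<and> smooth_on I \<alpha> \<and> smooth_on I \<beta> \<and>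
             compatibility_eq M0 I N \<rho> \<gamma> \<alpha> \<beta> \<and> enneper_param M0 I N \<rho> \<gamma> \<alpha> \<beta> f))"
proof -
  interpret spherical_map A M0 I N
    by unfold_locales (use assms in auto)
  show ?thesis
    using induced_metric_splits splits_imp_orthogonal enneper_type_regular gauss_map_regular converse
    by (intro conjI iffI allI impI; (elim conjE exE)?) blast+
qed

end
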